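(* Let $(X_j)_{j\in J}$ be a family of objects in a pre-Hilbert $*$-category $\mathbf{C}$, and let $\mathcal{F}J$ be the set of finite subsets of $J$, directed by inclusion. Consider the codirected diagram of coisometries $$\Bigl(p_F\colon\bigoplus_{j\in G}X_j\to\bigoplus_{j\in F}X_j\Bigr)_{F\subseteq G\in\mathcal{F}J}.$$ Under the canonical isomorphism from the category of spans on $(X_j)_{j\in J}$ to the category of cones on this diagram, $\ell^2$-spans correspond to $\ell^2$-cones, and $\ell^2$-products correspond to $\ell^2$-limits.
   Context: A $*$-category is a category equipped with a choice of morphism $f^*\colon Y\to X$ for each morphism $f\colon X\to Y$ such that $1^*=1$, $(gf)^*=f^*g^*$ and $(f^* )^*=f$. A morphism $f$ is an isometry if $f^*f=1$, and a coisometry if $ff^*=1$. In a $*$-category with a zero object, a finite product $(r_j\colon X\to X_j)_{j\in F}$ is orthonormal if each $r_j$ is a coisometry and $r_jr_k^*=0$ for $j\ne k$. A pre-Hilbert $*$-category is a $*$-category with a zero object, in which every pair of objects has an orthonormal product, every morphism has a kernel that is an isometry, and, for each object $X$, the diagonal $X\to X\oplus X$ (with both components $1$) is a kernel of some morphism. It is known that every pre-Hilbert $*$-category $\mathbf{C}$ is canonically enriched in rational vector spaces, with $(f+g)^*=f^*+g^*$; it has orthonormal products of all finite families, and these are biproducts. Chosen finite orthonormal products are denoted $(p_k\colon\bigoplus_{j\in F}X_j\to X_k)_{k\in F}$; the chosen one for a one-object family is taken to be the object itself. For each object $A$, the Hermitian elements ($a^*=a$) of $\mathbf{C}(A,A)$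 are partially ordered by: $f\le g$ iff $g-f=h^*h$ for some morphism $h\colon A\to X$. A morphism $f$ is a contraction if $f^*f\le 1$; coisometries are contractions. For finite $F\subseteq G\subseteq J$, $p_F\colon\bigoplus_{j\in G}X_j\to\bigoplus_{j\in F}X_j$ is the unique morphism with $p_jp_F=p_j$ for all $j\in F$. A cone on the resulting codirected diagram is a family $(g_F\colon Y\to\bigoplus_{j\in F}X_j)_{F\in\mathcal{F}J}$ with $p_Fg_G=g_F$ for all $F\subseteq G$. Morphisms of spans (respectively cones) are morphisms between the apexes commuting with all components. The canonical isomorphism sends a span $(g_j\colon Y\to X_j)_{j\in J}$ to the cone $(g_F)_{F\in\mathcal{F}J}$ whose component $g_F$ is the unique morphism with $p_jg_F=g_j$ for each $j\in F$, and is the identity on underlying morphisms; its inverse sends a cone $(g_F)_F$ to the span with $g_j=g_{\{j\}}$. An $\ell^2$-span on $(X_j)_{j\in J}$ is a span $(g_j\colon Y\to X_j)_{j\in J}$ such that the net $(\sum_{j\in F}g_j^*g_j)_{F\in\mathcal{F}J}$ in $\mathbf{C}(Y,Y)$ is bounded above. An $\ell^2$-product is an $\ell^2$-span $(r_j\colon X\to X_j)_{j\in J}$ such that for all $\ell^2$-spans $(g_j\colon Y\to X_j)_{j\in J}$ there is a unique $g\colon Y\to X$ with $r_jg=g_j$ for all $j$, and this $g$ satisfies $g^*g=\sup_{F\in\mathcal{F}J}\sum_{j\in F}g_j^*g_j$ (in particular this least upper bound exists). For a codirected diagram $(f_{i\le k}\colon Z_k\to Z_i)_{i,k\in I}$ of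 contractions indexed by a directed set $I$, an $\ell^2$-cone is a cone $(g_i\colon Y\to Z_i)_{i\in I}$ such that the net $(g_i^*g_i)_{i\in I}$ in $\mathbf{C}(Y,Y)$ is bounded above; an $\ell^2$-limit is an $\ell^2$-cone $(f_i\colon Z\to Z_i)_{i\in I}$ such that for all $\ell^2$-cones $(g_i\colon Y\to Z_i)_{i\in I}$ there is a unique $g\colon Y\to Z$ with $f_ig=g_i$ for all $i$, and this $g$ satisfies $g^*g=\sup_{i\in I}g_i^*g_i$. *)

theory Defs
  imports "HOL-Algebra.Ring" "HOL-Algebra.Order"
begin

section \<open>\<open>*\<close>-categories\<close>

record ('o, 'a) star_cat =
  Obj :: "'o set"
  Arr :: "'a set"
  Dom :: "'a \<Rightarrow> 'o"
  Cod :: "'a \<Rightarrow> 'o"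
  Id :: "'o \<Rightarrow> 'a"
  Comp :: "'a \<Rightarrow> 'a \<Rightarrow> 'a" (infixr "\<cdot>\<index>" 75)
  Star :: "'a \<Rightarrow> 'a" ("_\<^sup>\<star>\<index>" [1000] 999)

text \<open>Composition is written in the usual order: \<open>g \<cdot> f\<close> is \<open>g\<close> after \<open>f\<close>. Its value is
  irrelevant unless \<open>Cod f = Dom g\<close>.\<close>

definition Hom :: "('o, 'a) star_cat \<Rightarrow> 'o \<Rightarrow> 'o \<Rightarrow> 'a set" where
  "Hom C A B = {f \<in> Arr C. Dom C f = A \<and> Cod C f = B}"

locale star_category =
  fixes C :: "('o, 'a) star_cat" (structure)
  assumes Dom_in_Obj: "f \<in> Arr C \<Longrightarrow> Dom C f \<in> Obj C"
    and Cod_in_Obj: "f \<in> Arr C \<Longrightarrow> Cod C f \<in> Obj C"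
    and Id_in_Hom: "A \<in> Obj C \<Longrightarrow> Id C A \<in> Hom C A A"
    and Comp_in_Hom: "f \<in> Hom C A B \<Longrightarrow> g \<in> Hom C B D \<Longrightarrow> g \<cdot> f \<in> Hom C A D"
    and Comp_Id: "f \<in> Hom C A B \<Longrightarrow> f \<cdot> Id C A = f"
    and Id_Comp: "f \<in> Hom C A B \<Longrightarrow> Id C B \<cdot> f = f"
    and Comp_assoc: "f \<in> Hom C A B \<Longrightarrow> g \<in> Hom C B D \<Longrightarrow> h \<in> Hom C D E
          \<Longrightarrow> (h \<cdot> g) \<cdot> f = h \<cdot> (g \<cdot> f)"
    and Star_in_Hom: "f \<in> Hom C A B \<Longrightarrow> f\<^sup>\<star> \<in> Hom C B A"
    and Star_Id: "A \<in> Obj C \<Longrightarrow> (Id C A)\<^sup>\<star> = Id C A"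
    and Star_Comp: "f \<in> Hom C A B \<Longrightarrow> g \<in> Hom C B D \<Longrightarrow> (g \<cdot> f)\<^sup>\<star> = f\<^sup>\<star> \<cdot> g\<^sup>\<star>"
    and Star_Star: "f \<in> Arr C \<Longrightarrow> (f\<^sup>\<star>)\<^sup>\<star> = f"

definition isometry :: "('o, 'a) star_cat \<Rightarrow> 'a \<Rightarrow> bool" where
  "isometry C f \<longleftrightarrow> f \<in> Arr C \<and> f\<^sup>\<star>\<^bsub>C\<^esub> \<cdot>\<^bsub>C\<^esub> f = Id C (Dom C f)"

definition coisometry :: "('o, 'a) star_cat \<Rightarrow> 'a \<Rightarrow> bool" where
  "coisometry C f \<longleftrightarrow> f \<in> Arr C \<and> f \<cdot>\<^bsub>C\<^esub> f\<^sup>\<star>\<^bsub>C\<^esub> = Id C (Cod C f)"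

definition zero_object :: "('o, 'a) star_cat \<Rightarrow> 'o \<Rightarrow> bool" where
  "zero_object C Z \<longleftrightarrow> Z \<in> Obj C
     \<and> (\<forall>A \<in> Obj C. (\<exists>!f. f \<in> Hom C A Z) \<and> (\<exists>!f. f \<in> Hom C Z A))"

definition zero_mor :: "('o, 'a) star_cat \<Rightarrow> 'o \<Rightarrow> 'o \<Rightarrow> 'a" where
  "zero_mor C A B = (THE f. \<exists>Z u v. zero_object C Z \<and> u \<in> Hom C A Z \<and> v \<in> Hom C Z B
     \<and> f = v \<cdot>\<^bsub>C\<^esub> u)"

definition is_kernel :: "('o, 'a) star_cat \<Rightarrow> 'a \<Rightarrow> 'a \<Rightarrow> bool" where
  "is_kernel C f k \<longleftrightarrow> f \<in> Arr C \<and> k \<in> Arr C \<and> Cod C k = Dom C f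
     \<and> f \<cdot>\<^bsub>C\<^esub> k = zero_mor C (Dom C k) (Cod C f)
     \<and> (\<forall>t \<in> Arr C. Cod C t = Dom C f \<and> f \<cdot>\<^bsub>C\<^esub> t = zero_mor C (Dom C t) (Cod C f)
          \<longrightarrow> (\<exists>!s. s \<in> Hom C (Dom C t) (Dom C k) \<and> k \<cdot>\<^bsub>C\<^esub> s = t))"

definition is_product ::
  "('o, 'a) star_cat \<Rightarrow> 'j set \<Rightarrow> ('j \<Rightarrow> 'o) \<Rightarrow> 'o \<Rightarrow> ('j \<Rightarrow> 'a) \<Rightarrow> bool" where
  "is_product C F X P r \<longleftrightarrow> P \<in> Obj C \<and> (\<forall>j \<in> F. r j \<in> Hom C P (X j))
     \<and> (\<forall>Y \<in> Obj C. \<forall>g. (\<forall>j \<in> F. g j \<in> Hom C Y (X j))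
          \<longrightarrow> (\<exists>!h. h \<in> Hom C Y P \<and> (\<forall>j \<in> F. r j \<cdot>\<^bsub>C\<^esub> h = g j)))"

definition orthonormal_product ::
  "('o, 'a) star_cat \<Rightarrow> 'j set \<Rightarrow> ('j \<Rightarrow> 'o) \<Rightarrow> 'o \<Rightarrow> ('j \<Rightarrow> 'a) \<Rightarrow> bool" where
  "orthonormal_product C F X P r \<longleftrightarrow> finite F \<and> is_product C F X P r
     \<and> (\<forall>j \<in> F. coisometry C (r j))
     \<and> (\<forall>j \<in> F. \<forall>k \<in> F. j \<noteq> k \<longrightarrow> r j \<cdot>\<^bsub>C\<^esub> (r k)\<^sup>\<star>\<^bsub>C\<^esub> = zero_mor C (X k) (X j))"


section \<open>Pre-Hilbert \<open>*\<close>-categories\<close>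

text \<open>Pairs of objects are families indexed by \<^typ>\<open>bool\<close>. Whether the diagonal into an
  orthonormal product of \<open>A\<close> with itself is a kernel does not depend on the choice of that
  product.\<close>

locale pre_hilbert_category = star_category +
  assumes zero_object_exists: "\<exists>Z. zero_object C Z"
    and binary_products: "A \<in> Obj C \<Longrightarrow> B \<in> Obj C \<Longrightarrow>
          \<exists>P r. orthonormal_product C UNIV (\<lambda>b::bool. if b then A else B) P r"
    and isometric_kernels: "f \<in> Arr C \<Longrightarrow> \<exists>k. is_kernel C f k \<and> isometry C k"
    and diagonal_kernel: "A \<in> Obj C \<Longrightarrow> orthonormal_product C UNIV (\<lambda>_::bool. A) P r \<Longrightarrow>
          d \<in> Hom C A P \<Longrightarrow> \<forall>b. r b \<cdot> d = Id C A \<Longrightarrow> \<exists>f. is_kernel C f d"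

text \<open>The canonical addition is the one determined by the biproduct structure: \<open>f + g\<close> is
  \<open>A \<rightarrow> B \<oplus> B \<rightarrow> B\<close>, the pairing \<open>u\<close> of \<open>f\<close> and \<open>g\<close> followed by the codiagonal \<open>c\<close>, where the
  coprojections of an orthonormal product are the adjoints of its projections.\<close>

definition plus_mor :: "('o, 'a) star_cat \<Rightarrow> 'a \<Rightarrow> 'a \<Rightarrow> 'a" where
  "plus_mor C f g = (THE s. \<exists>P r u c.
     orthonormal_product C UNIV (\<lambda>_::bool. Cod C f) P r
     \<and> u \<in> Hom C (Dom C f) P \<and> r True \<cdot>\<^bsub>C\<^esub> u = f \<and> r False \<cdot>\<^bsub>C\<^esub> u = g
     \<and> c \<in> Hom C P (Cod C f) \<and> (\<forall>b. c \<cdot>\<^bsub>C\<^esub> (r b)\<^sup>\<star>\<^bsub>C\<^esub> = Id C (Cod C f))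
     \<and> s = c \<cdot>\<^bsub>C\<^esub> u)"

definition End :: "('o, 'a) star_cat \<Rightarrow> 'o \<Rightarrow> 'a ring" where
  "End C A = \<lparr>carrier = Hom C A A, mult = Comp C, one = Id C A,
     zero = zero_mor C A A, add = plus_mor C\<rparr>"

definition Herm :: "('o, 'a) star_cat \<Rightarrow> 'o \<Rightarrow> 'a gorder" where
  "Herm C A = \<lparr>carrier = {a \<in> Hom C A A. a\<^sup>\<star>\<^bsub>C\<^esub> = a}, eq = (=),
     le = (\<lambda>f g. \<exists>h \<in> Arr C. Dom C h = A \<and> g \<ominus>\<^bsub>End C A\<^esub> f = h\<^sup>\<star>\<^bsub>C\<^esub> \<cdot>\<^bsub>C\<^esub> h)\<rparr>"

definition contraction :: "('o, 'a) star_cat \<Rightarrow> 'a \<Rightarrow> bool" where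
  "contraction C f \<longleftrightarrow> f \<in> Arr C \<and> f\<^sup>\<star>\<^bsub>C\<^esub> \<cdot>\<^bsub>C\<^esub> f \<sqsubseteq>\<^bsub>Herm C (Dom C f)\<^esub> Id C (Dom C f)"


section \<open>Spans and \<open>\<ell>\<^sup>2\<close>-products\<close>

text \<open>A span is a pair of its apex and its (extensional) family of components.\<close>

definition spans :: "('o, 'a) star_cat \<Rightarrow> 'j set \<Rightarrow> ('j \<Rightarrow> 'o) \<Rightarrow> ('o \<times> ('j \<Rightarrow> 'a)) set" where
  "spans C J X = {(Y, g). Y \<in> Obj C \<and> g \<in> (\<Pi>\<^sub>E j \<in> J. Hom C Y (X j))}"

definition span_hom ::
  "('o, 'a) star_cat \<Rightarrow> 'j set \<Rightarrow> 'o \<times> ('j \<Rightarrow> 'a) \<Rightarrow> 'o \<times> ('j \<Rightarrow> 'a) \<Rightarrow> 'a set" where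
  "span_hom C J S T = {h \<in> Hom C (fst S) (fst T). \<forall>j \<in> J. snd T j \<cdot>\<^bsub>C\<^esub> h = snd S j}"

definition l2_net :: "('o, 'a) star_cat \<Rightarrow> 'o \<times> ('j \<Rightarrow> 'a) \<Rightarrow> 'j set \<Rightarrow> 'a" where
  "l2_net C S F = (\<Oplus>\<^bsub>End C (fst S)\<^esub> j \<in> F. (snd S j)\<^sup>\<star>\<^bsub>C\<^esub> \<cdot>\<^bsub>C\<^esub> snd S j)"

definition l2_spans :: "('o, 'a) star_cat \<Rightarrow> 'j set \<Rightarrow> ('j \<Rightarrow> 'o) \<Rightarrow> ('o \<times> ('j \<Rightarrow> 'a)) set" where
  "l2_spans C J X = {S \<in> spans C J X. Upper (Herm C (fst S)) (l2_net C S ` Fpow J) \<noteq> {}}"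

definition l2_products :: "('o, 'a) star_cat \<Rightarrow> 'j set \<Rightarrow> ('j \<Rightarrow> 'o) \<Rightarrow> ('o \<times> ('j \<Rightarrow> 'a)) set" where
  "l2_products C J X = {R \<in> l2_spans C J X. \<forall>S \<in> l2_spans C J X.
     \<exists>g. span_hom C J S R = {g}
       \<and> least (Herm C (fst S)) (g\<^sup>\<star>\<^bsub>C\<^esub> \<cdot>\<^bsub>C\<^esub> g) (Upper (Herm C (fst S)) (l2_net C S ` Fpow J))}"


section \<open>Codirected diagrams and \<open>\<ell>\<^sup>2\<close>-limits\<close>

definition directed_set :: "'i set \<Rightarrow> ('i \<Rightarrow> 'i \<Rightarrow> bool) \<Rightarrow> bool" where
  "directed_set I lei \<longleftrightarrow> I \<noteq> {} \<and> (\<forall>i \<in> I. lei i i)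
     \<and> (\<forall>i \<in> I. \<forall>k \<in> I. \<forall>l \<in> I. lei i k \<and> lei k l \<longrightarrow> lei i l)
     \<and> (\<forall>i \<in> I. \<forall>k \<in> I. \<exists>l \<in> I. lei i l \<and> lei k l)"

text \<open>For \<open>i \<le> k\<close>, the diagram has the morphism \<open>f i k\<close> from \<open>Z k\<close> to \<open>Z i\<close>.\<close>

definition codirected_diagram ::
  "('o, 'a) star_cat \<Rightarrow> 'i set \<Rightarrow> ('i \<Rightarrow> 'i \<Rightarrow> bool) \<Rightarrow> ('i \<Rightarrow> 'o) \<Rightarrow> ('i \<Rightarrow> 'i \<Rightarrow> 'a) \<Rightarrow> bool" where
  "codirected_diagram C I lei Z f \<longleftrightarrow> directed_set I lei
     \<and> (\<forall>i \<in> I. Z i \<in> Obj C \<and> f i i = Id C (Z i))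
     \<and> (\<forall>i \<in> I. \<forall>k \<in> I. lei i k \<longrightarrow> f i k \<in> Hom C (Z k) (Z i))
     \<and> (\<forall>i \<in> I. \<forall>k \<in> I. \<forall>l \<in> I. lei i k \<and> lei k l \<longrightarrow> f i k \<cdot>\<^bsub>C\<^esub> f k l = f i l)"

text \<open>A cone is in particular a span on the objects of the diagram, and a morphism of cones is a
  morphism of the underlying spans (an element of \<open>span_hom C I S T\<close>).\<close>

definition cones ::
  "('o, 'a) star_cat \<Rightarrow> 'i set \<Rightarrow> ('i \<Rightarrow> 'i \<Rightarrow> bool) \<Rightarrow> ('i \<Rightarrow> 'o) \<Rightarrow> ('i \<Rightarrow> 'i \<Rightarrow> 'a)
     \<Rightarrow> ('o \<times> ('i \<Rightarrow> 'a)) set" where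
  "cones C I lei Z f = {S \<in> spans C I Z.
     \<forall>i \<in> I. \<forall>k \<in> I. lei i k \<longrightarrow> f i k \<cdot>\<^bsub>C\<^esub> snd S k = snd S i}"

definition cone_net :: "('o, 'a) star_cat \<Rightarrow> 'o \<times> ('i \<Rightarrow> 'a) \<Rightarrow> 'i \<Rightarrow> 'a" where
  "cone_net C S i = (snd S i)\<^sup>\<star>\<^bsub>C\<^esub> \<cdot>\<^bsub>C\<^esub> snd S i"

text \<open>The following two notions are meant for codirected diagrams of contractions.\<close>

definition l2_cones ::
  "('o, 'a) star_cat \<Rightarrow> 'i set \<Rightarrow> ('i \<Rightarrow> 'i \<Rightarrow> bool) \<Rightarrow> ('i \<Rightarrow> 'o) \<Rightarrow> ('i \<Rightarrow> 'i \<Rightarrow> 'a)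
     \<Rightarrow> ('o \<times> ('i \<Rightarrow> 'a)) set" where
  "l2_cones C I lei Z f =
     {S \<in> cones C I lei Z f. Upper (Herm C (fst S)) (cone_net C S ` I) \<noteq> {}}"

definition l2_limits ::
  "('o, 'a) star_cat \<Rightarrow> 'i set \<Rightarrow> ('i \<Rightarrow> 'i \<Rightarrow> bool) \<Rightarrow> ('i \<Rightarrow> 'o) \<Rightarrow> ('i \<Rightarrow> 'i \<Rightarrow> 'a)
     \<Rightarrow> ('o \<times> ('i \<Rightarrow> 'a)) set" where
  "l2_limits C I lei Z f = {R \<in> l2_cones C I lei Z f. \<forall>S \<in> l2_cones C I lei Z f.
     \<exists>g. span_hom C I S R = {g}
       \<and> least (Herm C (fst S)) (g\<^sup>\<star>\<^bsub>C\<^esub> \<cdot>\<^bsub>C\<^esub> g) (Upper (Herm C (fst S)) (cone_net C S ` I))}"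


section \<open>The diagram of finite sums of a family\<close>

text \<open>A choice of an orthonormal product \<open>(p F j : Q F \<rightarrow> X j)\<close>, \<open>j \<in> F\<close>, for each finite subfamily;
  the one for a one-object family is the object itself.\<close>

definition chosen_sums ::
  "('o, 'a) star_cat \<Rightarrow> 'j set \<Rightarrow> ('j \<Rightarrow> 'o) \<Rightarrow> ('j set \<Rightarrow> 'o) \<Rightarrow> ('j set \<Rightarrow> 'j \<Rightarrow> 'a) \<Rightarrow> bool" where
  "chosen_sums C J X Q p \<longleftrightarrow> (\<forall>F \<in> Fpow J. orthonormal_product C F X (Q F) (p F))
     \<and> (\<forall>j \<in> J. Q {j} = X j \<and> p {j} j = Id C (X j))"

definition sum_proj ::
  "('o, 'a) star_cat \<Rightarrow> ('j set \<Rightarrow> 'o) \<Rightarrow> ('j set \<Rightarrow> 'j \<Rightarrow> 'a) \<Rightarrow> 'j set \<Rightarrow> 'j set \<Rightarrow> 'a" where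
  "sum_proj C Q p F G =
     (THE h. h \<in> Hom C (Q G) (Q F) \<and> (\<forall>j \<in> F. p F j \<cdot>\<^bsub>C\<^esub> h = p G j))"

definition cone_of_span ::
  "('o, 'a) star_cat \<Rightarrow> 'j set \<Rightarrow> ('j set \<Rightarrow> 'o) \<Rightarrow> ('j set \<Rightarrow> 'j \<Rightarrow> 'a)
     \<Rightarrow> 'o \<times> ('j \<Rightarrow> 'a) \<Rightarrow> 'o \<times> ('j set \<Rightarrow> 'a)" where
  "cone_of_span C J Q p S = (fst S, \<lambda>F \<in> Fpow J.
     THE h. h \<in> Hom C (fst S) (Q F) \<and> (\<forall>j \<in> F. p F j \<cdot>\<^bsub>C\<^esub> h = snd S j))"

definition span_of_cone :: "'j set \<Rightarrow> 'o \<times> ('j set \<Rightarrow> 'a) \<Rightarrow> 'o \<times> ('j \<Rightarrow> 'a)" where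
  "span_of_cone J T = (fst T, \<lambda>j \<in> J. snd T {j})"

end

theory Submission
  imports Defs
begin

text \<open>
  The correspondence rests on two facts about the tupling \<open>g\<^sub>F : Y \<rightarrow> \<Oplus>j\<in>F. X j\<close> of the components
  \<open>g j\<close>, \<open>j \<in> F\<close>, of a span.

  First, spans and cones determine each other. By the universal property of the finite products the
  tuplings of a span form a cone; since the chosen product of the family \<open>{j}\<close> is \<open>X j\<close> itself, the
  projection from \<open>F\<close> to \<open>{j}\<close> is the product projection, so that a cone is recovered from its
  components at singletons. The same argument shows that a morphism between the apexes commutes with
  the components of two spans iff it commutes with those of the two cones.

  Second, Parseval's identity \<open>g\<^sub>F\<^sup>\<star> \<cdot> g\<^sub>F = \<Sum>j\<in>F. (g j)\<^sup>\<star> \<cdot> g j\<close> (lemma \<open>tuple_norm\<close>) holds, because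
  \<open>\<Sum>j\<in>F. (p j)\<^sup>\<star> \<cdot> p j = 1\<close> in a finite orthonormal product. Hence the nets that define
  \<open>\<ell>\<^sup>2\<close>-spans and \<open>\<ell>\<^sup>2\<close>-cones are equal, and with them their upper bounds and least
  upper bounds. As the conditions that define \<open>\<ell>\<^sup>2\<close>-products and \<open>\<ell>\<^sup>2\<close>-limits involve
  only these nets and the sets of morphisms into the given span or cone, they agree as well.

  That \<open>p\<^sub>F\<close> is a contraction follows from the same identity: \<open>1 = p\<^sub>F\<^sup>\<star> \<cdot> p\<^sub>F + q\<^sup>\<star> \<cdot> q\<close>, where
  \<open>q\<close> is the projection onto the complementary summand. To read this as
  \<open>1 - p\<^sub>F\<^sup>\<star> \<cdot> p\<^sub>F = q\<^sup>\<star> \<cdot> q\<close>, the addition of morphisms must be an abelian group. Everything except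
  additive inverses comes from the biproduct structure. For the inverse of \<open>1\<close> on \<open>A\<close>, let
  \<open>(u, v) : K \<rightarrow> A \<oplus> A\<close> be an isometric kernel of the codiagonal. Then \<open>u + v = 0\<close> and
  \<open>u\<^sup>\<star> \<cdot> u + v\<^sup>\<star> \<cdot> v = 1\<close>, whence \<open>u\<^sup>\<star> \<cdot> (1 + v \<cdot> u\<^sup>\<star> + v \<cdot> u\<^sup>\<star>) = 0\<close>; and \<open>u\<^sup>\<star> \<cdot> t = 0\<close> implies
  \<open>t = 0\<close> because the diagonal is a kernel. So \<open>v \<cdot> u\<^sup>\<star> + v \<cdot> u\<^sup>\<star>\<close> is the inverse of \<open>1\<close>.
\<close>

section \<open>Morphisms and zero morphisms\<close>

context star_category
begin

text \<open>The axioms restated with side conditions on domains and codomains instead of membership in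
  hom-sets. In this form they can be used as conditional rewrite rules, which type composites and
  normalise them.\<close>

lemma comp_typing [simp]:
  assumes "f \<in> Arr C" "g \<in> Arr C" "Cod C f = Dom C g"
  shows "g \<cdot> f \<in> Arr C" "Dom C (g \<cdot> f) = Dom C f" "Cod C (g \<cdot> f) = Cod C g"
  using Comp_in_Hom[of f "Dom C f" "Dom C g" g "Cod C g"] assms by (simp_all add: Hom_def)

lemma star_typing [simp]:
  assumes "f \<in> Arr C"
  shows "f\<^sup>\<star> \<in> Arr C" "Dom C (f\<^sup>\<star>) = Cod C f" "Cod C (f\<^sup>\<star>) = Dom C f"
  using Star_in_Hom[of f "Dom C f" "Cod C f"] assms by (simp_all add: Hom_def)

lemma id_typing [simp]:
  assumes "A \<in> Obj C"
  shows "Id C A \<in> Arr C" "Dom C (Id C A) = A" "Cod C (Id C A) = A"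
  using Id_in_Hom[OF assms] by (simp_all add: Hom_def)

lemma comp_assoc [simp]:
  assumes "f \<in> Arr C" "g \<in> Arr C" "h \<in> Arr C" "Cod C f = Dom C g" "Cod C g = Dom C h"
  shows "(h \<cdot> g) \<cdot> f = h \<cdot> (g \<cdot> f)"
  using Comp_assoc[of f "Dom C f" "Dom C g" g "Dom C h" h "Cod C h"] assms by (simp_all add: Hom_def)

lemma star_comp [simp]:
  assumes "f \<in> Arr C" "g \<in> Arr C" "Cod C f = Dom C g"
  shows "(g \<cdot> f)\<^sup>\<star> = f\<^sup>\<star> \<cdot> g\<^sup>\<star>"
  using Star_Comp[of f "Dom C f" "Dom C g" g "Cod C g"] assms by (simp_all add: Hom_def)

lemma comp_id [simp]: "f \<in> Arr C \<Longrightarrow> Dom C f = A \<Longrightarrow> f \<cdot> Id C A = f"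
  using Comp_Id[of f A "Cod C f"] by (simp_all add: Hom_def)

lemma id_comp [simp]: "f \<in> Arr C \<Longrightarrow> Cod C f = A \<Longrightarrow> Id C A \<cdot> f = f"
  using Id_Comp[of f "Dom C f" A] by (simp_all add: Hom_def)

declare Dom_in_Obj [simp] Cod_in_Obj [simp] Star_Id [simp] Star_Star [simp]

lemma hom_obj: "f \<in> Hom C A B \<Longrightarrow> A \<in> Obj C \<and> B \<in> Obj C"
  unfolding Hom_def using Dom_in_Obj Cod_in_Obj by blast

lemma star_inject: "f \<in> Arr C \<Longrightarrow> g \<in> Arr C \<Longrightarrow> f\<^sup>\<star> = g\<^sup>\<star> \<Longrightarrow> f = g"
  by (metis Star_Star)

lemma to_zero_object_unique:
  assumes "zero_object C Z" "f \<in> Hom C A Z" "g \<in> Hom C A Z"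
  shows "f = g"
proof -
  have "\<exists>!f. f \<in> Hom C A Z"
    using assms hom_obj[OF assms(2)] by (simp add: zero_object_def)
  then show ?thesis
    using assms(2,3) by (metis (no_types))
qed

lemma from_zero_object_unique:
  assumes "zero_object C Z" "f \<in> Hom C Z A" "g \<in> Hom C Z A"
  shows "f = g"
proof -
  have "\<exists>!f. f \<in> Hom C Z A"
    using assms hom_obj[OF assms(2)] by (simp add: zero_object_def)
  then show ?thesis
    using assms(2,3) by (metis (no_types))
qed

lemma comp_through_zero_unique:
  assumes "zero_object C Z" "u \<in> Hom C A Z" "v \<in> Hom C Z B"
    and "zero_object C Z'" "u' \<in> Hom C A Z'" "v' \<in> Hom C Z' B"
  shows "v \<cdot> u = v' \<cdot> u'"
proof -
  have "Z' \<in> Obj C"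
    using assms(5) hom_obj by blast
  then have "\<exists>!i. i \<in> Hom C Z Z'"
    using assms(1) by (simp add: zero_object_def)
  then obtain i where i: "i \<in> Hom C Z Z'"
    by (rule ex1E)
  have "i \<cdot> u = u'"
    by (rule to_zero_object_unique[OF assms(4) Comp_in_Hom[OF assms(2) i] assms(5)])
  moreover have "v' \<cdot> i = v"
    by (rule from_zero_object_unique[OF assms(1) Comp_in_Hom[OF i assms(6)] assms(3)])
  moreover have "(v' \<cdot> i) \<cdot> u = v' \<cdot> (i \<cdot> u)"
    by (rule Comp_assoc[OF assms(2) i assms(6)])
  ultimately show ?thesis
    by simp
qed

lemma zero_mor_eqI:
  assumes "zero_object C Z" "u \<in> Hom C A Z" "v \<in> Hom C Z B"
  shows "zero_mor C A B = v \<cdot> u"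
  unfolding zero_mor_def
proof (rule the_equality)
  show "\<exists>Z w x. zero_object C Z \<and> w \<in> Hom C A Z \<and> x \<in> Hom C Z B \<and> v \<cdot> u = x \<cdot> w"
    using assms by blast
next
  fix f
  assume "\<exists>Z u v. zero_object C Z \<and> u \<in> Hom C A Z \<and> v \<in> Hom C Z B \<and> f = v \<cdot> u"
  then show "f = v \<cdot> u"
    by (elim exE conjE) (simp only: comp_through_zero_unique[OF _ _ _ assms])
qed

lemma orthonormal_product_obj: "orthonormal_product C F X P r \<Longrightarrow> P \<in> Obj C"
  unfolding orthonormal_product_def is_product_def by (elim conjE)

lemma orthonormal_product_hom:
  "orthonormal_product C F X P r \<Longrightarrow> j \<in> F \<Longrightarrow> r j \<in> Hom C P (X j)"
  unfolding orthonormal_product_def is_product_def by (elim conjE) (erule (1) bspec)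

lemma orthonormal_product_factor_obj:
  "orthonormal_product C F X P r \<Longrightarrow> j \<in> F \<Longrightarrow> X j \<in> Obj C"
  by (rule conjunct2[OF hom_obj[OF orthonormal_product_hom]])

lemma orthonormal_product_ex1:
  assumes "orthonormal_product C F X P r" "Y \<in> Obj C" "\<And>j. j \<in> F \<Longrightarrow> g j \<in> Hom C Y (X j)"
  shows "\<exists>!h. h \<in> Hom C Y P \<and> (\<forall>j \<in> F. r j \<cdot> h = g j)"
proof -
  have "\<forall>Y \<in> Obj C. \<forall>g. (\<forall>j \<in> F. g j \<in> Hom C Y (X j))
      \<longrightarrow> (\<exists>!h. h \<in> Hom C Y P \<and> (\<forall>j \<in> F. r j \<cdot> h = g j))"
    using assms(1) unfolding orthonormal_product_def is_product_def by (elim conjE)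
  from spec[OF bspec[OF this assms(2)], of g] show ?thesis
    using assms(3) by simp
qed

lemma orthonormal_product_pairing:
  assumes "orthonormal_product C F X P r" "Y \<in> Obj C" "\<And>j. j \<in> F \<Longrightarrow> g j \<in> Hom C Y (X j)"
  obtains h where "h \<in> Hom C Y P" "\<And>j. j \<in> F \<Longrightarrow> r j \<cdot> h = g j"
  using ex1_implies_ex[OF orthonormal_product_ex1[OF assms]] by auto

lemma orthonormal_product_eqI:
  assumes r: "orthonormal_product C F X P r" and h: "h \<in> Hom C Y P" "h' \<in> Hom C Y P"
    and eq: "\<And>j. j \<in> F \<Longrightarrow> r j \<cdot> h = r j \<cdot> h'"
  shows "h = h'"
proof -
  have Y: "Y \<in> Obj C"
    using hom_obj[OF h(1)] by simp
  have g: "r j \<cdot> h' \<in> Hom C Y (X j)" if "j \<in> F" for j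
    using orthonormal_product_hom[OF r that] h by (simp add: Hom_def)
  have "\<exists>!x. x \<in> Hom C Y P \<and> (\<forall>j \<in> F. r j \<cdot> x = r j \<cdot> h')"
    by (rule orthonormal_product_ex1[OF r Y g])
  moreover have "h \<in> Hom C Y P \<and> (\<forall>j \<in> F. r j \<cdot> h = r j \<cdot> h')"
      "h' \<in> Hom C Y P \<and> (\<forall>j \<in> F. r j \<cdot> h' = r j \<cdot> h')"
    using h eq by blast+
  ultimately show ?thesis
    by (metis (no_types, lifting))
qed

text \<open>The adjoints of the projections are jointly epic, so that an orthonormal product is also
  a coproduct.\<close>

lemma orthonormal_product_dual_eqI:
  assumes r: "orthonormal_product C F X P r" and k: "k \<in> Hom C P Z" "k' \<in> Hom C P Z"
    and eq: "\<And>j. j \<in> F \<Longrightarrow> k \<cdot> (r j)\<^sup>\<star> = k' \<cdot> (r j)\<^sup>\<star>"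
  shows "k = k'"
proof -
  have "k\<^sup>\<star> = k'\<^sup>\<star>"
  proof (rule orthonormal_product_eqI[OF r])
    show "k\<^sup>\<star> \<in> Hom C Z P" "k'\<^sup>\<star> \<in> Hom C Z P"
      using k by (simp_all add: Hom_def)
    fix j assume j: "j \<in> F"
    have "(k \<cdot> (r j)\<^sup>\<star>)\<^sup>\<star> = (k' \<cdot> (r j)\<^sup>\<star>)\<^sup>\<star>"
      by (simp only: eq[OF j])
    then show "r j \<cdot> k\<^sup>\<star> = r j \<cdot> k'\<^sup>\<star>"
      using orthonormal_product_hom[OF r j] k by (simp add: Hom_def)
  qed
  then show ?thesis
    using k by (simp add: star_inject Hom_def)
qed

lemma orthonormal_product_same:
  assumes "orthonormal_product C F X P r" "j \<in> F"
  shows "r j \<cdot> (r j)\<^sup>\<star> = Id C (X j)"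
proof -
  have "coisometry C (r j)"
    using assms unfolding orthonormal_product_def by (elim conjE) (erule (1) bspec)
  then show ?thesis
    using orthonormal_product_hom[OF assms] by (simp add: coisometry_def Hom_def)
qed

lemma orthonormal_product_diff:
  assumes "orthonormal_product C F X P r" "j \<in> F" "k \<in> F" "j \<noteq> k"
  shows "r j \<cdot> (r k)\<^sup>\<star> = zero_mor C (X k) (X j)"
  using assms unfolding orthonormal_product_def by (elim conjE) (blast dest!: bspec)

end

context pre_hilbert_category
begin

lemma zero_mor_factors:
  assumes A: "A \<in> Obj C" and B: "B \<in> Obj C"
  obtains Z u v where "zero_object C Z" "u \<in> Hom C A Z" "v \<in> Hom C Z B" "zero_mor C A B = v \<cdot> u"
proof -
  obtain Z where Z: "zero_object C Z"
    using zero_object_exists by blast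
  have "\<exists>!u. u \<in> Hom C A Z"
    using Z A by (simp add: zero_object_def)
  then obtain u where u: "u \<in> Hom C A Z"
    by (rule ex1E)
  have "\<exists>!v. v \<in> Hom C Z B"
    using Z B by (simp add: zero_object_def)
  then obtain v where v: "v \<in> Hom C Z B"
    by (rule ex1E)
  show ?thesis
    by (rule that[OF Z u v zero_mor_eqI[OF Z u v]])
qed

lemma zero_mor_in_Hom:
  assumes "A \<in> Obj C" "B \<in> Obj C"
  shows "zero_mor C A B \<in> Hom C A B"
  by (rule zero_mor_factors[OF assms]) (simp add: Comp_in_Hom)

lemma zero_mor_typing [simp]:
  assumes "A \<in> Obj C" "B \<in> Obj C"
  shows "zero_mor C A B \<in> Arr C" "Dom C (zero_mor C A B) = A" "Cod C (zero_mor C A B) = B"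
  using zero_mor_in_Hom[OF assms] by (simp_all add: Hom_def)

lemma zero_mor_comp [simp]:
  assumes f: "f \<in> Arr C" "Cod C f = B" and D: "D \<in> Obj C"
  shows "zero_mor C B D \<cdot> f = zero_mor C (Dom C f) D"
proof -
  have "B \<in> Obj C"
    using f by auto
  then obtain Z u v where Z: "zero_object C Z" "u \<in> Hom C B Z" "v \<in> Hom C Z D"
      "zero_mor C B D = v \<cdot> u"
    by (rule zero_mor_factors[OF _ D])
  have "u \<cdot> f \<in> Hom C (Dom C f) Z"
    using f Z by (simp_all add: Hom_def)
  then have "zero_mor C (Dom C f) D = v \<cdot> (u \<cdot> f)"
    using zero_mor_eqI Z by blast
  then show ?thesis
    using f Z by (simp_all add: Hom_def)
qed

lemma comp_zero_mor [simp]: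
  assumes f: "f \<in> Arr C" "Dom C f = B" and A: "A \<in> Obj C"
  shows "f \<cdot> zero_mor C A B = zero_mor C A (Cod C f)"
proof -
  have "B \<in> Obj C"
    using f by auto
  then obtain Z u v where Z: "zero_object C Z" "u \<in> Hom C A Z" "v \<in> Hom C Z B"
      "zero_mor C A B = v \<cdot> u"
    by (rule zero_mor_factors[OF A])
  have "f \<cdot> v \<in> Hom C Z (Cod C f)"
    using f Z by (simp_all add: Hom_def)
  then have "zero_mor C A (Cod C f) = (f \<cdot> v) \<cdot> u"
    using zero_mor_eqI Z by blast
  then show ?thesis
    using f Z by (simp_all add: Hom_def)
qed

lemma star_zero_mor [simp]:
  assumes "A \<in> Obj C" "B \<in> Obj C"
  shows "(zero_mor C A B)\<^sup>\<star> = zero_mor C B A"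
proof -
  obtain Z u v where Z: "zero_object C Z" "u \<in> Hom C A Z" "v \<in> Hom C Z B"
      "zero_mor C A B = v \<cdot> u"
    using zero_mor_factors assms by blast
  have "zero_mor C B A = u\<^sup>\<star> \<cdot> v\<^sup>\<star>"
    using zero_mor_eqI Z Star_in_Hom by blast
  then show ?thesis
    using Z by (simp_all add: Hom_def)
qed


section \<open>Addition of morphisms\<close>

text \<open>The canonical addition, determined by the biproducts.\<close>

abbreviation add_mor (infixl "\<boxplus>" 65) where "f \<boxplus> g \<equiv> plus_mor C f g"

lemma constant_pair_product:
  assumes "A \<in> Obj C"
  obtains P r where "orthonormal_product C UNIV (\<lambda>_::bool. A) P r"
  using binary_products[OF assms assms] by auto

text \<open>The composite of \<open>h : Y \<rightarrow> X True \<oplus> X False\<close> and \<open>k : X True \<oplus> X False \<rightarrow> Z\<close> equals the composite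
  through \<open>Z \<oplus> Z\<close> that computes the sum of the two products of components, whatever
  orthonormal product \<open>Z \<oplus> Z\<close> is used. For \<open>k\<close> a codiagonal this says that the sum does not depend on
  this choice.\<close>

lemma pairing_codiagonal_eq_comp:
  assumes r: "orthonormal_product C (UNIV::bool set) X P r"
    and h: "h \<in> Hom C Y P" and k: "k \<in> Hom C P Z"
    and r': "orthonormal_product C UNIV (\<lambda>_::bool. Z) P' r'"
    and u: "u \<in> Hom C Y P'" "\<And>b. r' b \<cdot> u = (k \<cdot> (r b)\<^sup>\<star>) \<cdot> (r b \<cdot> h)"
    and c: "c \<in> Hom C P' Z" "\<And>b. c \<cdot> (r' b)\<^sup>\<star> = Id C Z"
  shows "c \<cdot> u = k \<cdot> h"
proof -
  note rh = orthonormal_product_hom[OF r UNIV_I] orthonormal_product_hom[OF r' UNIV_I]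
  have P: "P \<in> Obj C"
    using h hom_obj by blast
  \<comment> \<open>\<open>m\<close> is the direct sum of the two components of \<open>k\<close>\<close>
  obtain m where m: "m \<in> Hom C P P'" "\<And>b. r' b \<cdot> m = (k \<cdot> (r b)\<^sup>\<star>) \<cdot> r b"
  proof (rule orthonormal_product_pairing[OF r' P, of "\<lambda>b. (k \<cdot> (r b)\<^sup>\<star>) \<cdot> r b"])
    show "(k \<cdot> (r b)\<^sup>\<star>) \<cdot> r b \<in> Hom C P Z" for b
      using k rh(1)[of b] by (simp_all add: Hom_def)
  qed auto
  note hom = h[unfolded Hom_def] k[unfolded Hom_def] u(1)[unfolded Hom_def]
    c(1)[unfolded Hom_def] m(1)[unfolded Hom_def]
    rh[unfolded Hom_def]
  have "u = m \<cdot> h"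
  proof (rule orthonormal_product_eqI[OF r' u(1)])
    show "m \<cdot> h \<in> Hom C Y P'"
      using Comp_in_Hom h m by blast
    fix b
    have "r' b \<cdot> (m \<cdot> h) = (r' b \<cdot> m) \<cdot> h"
      using hom by simp
    then show "r' b \<cdot> u = r' b \<cdot> (m \<cdot> h)"
      unfolding m(2) u(2) using hom by simp
  qed
  moreover have "c \<cdot> m = k"
  proof (rule orthonormal_product_dual_eqI[OF r _ k])
    show "c \<cdot> m \<in> Hom C P Z"
      using Comp_in_Hom c m by blast
    fix b
    have "m \<cdot> (r b)\<^sup>\<star> = (r' b)\<^sup>\<star> \<cdot> (k \<cdot> (r b)\<^sup>\<star>)"
    proof (rule orthonormal_product_eqI[OF r'])
      show "m \<cdot> (r b)\<^sup>\<star> \<in> Hom C (X b) P'" "(r' b)\<^sup>\<star> \<cdot> (k \<cdot> (r b)\<^sup>\<star>) \<in> Hom C (X b) P'"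
        using hom by (simp_all add: Hom_def)
      fix d
      have "r' d \<cdot> (m \<cdot> (r b)\<^sup>\<star>) = (r' d \<cdot> m) \<cdot> (r b)\<^sup>\<star>"
        using hom by simp
      also have "\<dots> = (k \<cdot> (r d)\<^sup>\<star>) \<cdot> (r d \<cdot> (r b)\<^sup>\<star>)"
        unfolding m(2) using hom by simp
      also have "\<dots> = (r' d \<cdot> (r' b)\<^sup>\<star>) \<cdot> (k \<cdot> (r b)\<^sup>\<star>)"
      proof (cases "d = b")
        case True
        have "X b \<in> Obj C" "Z \<in> Obj C"
          using rh(1) k hom_obj by blast+
        then show ?thesis
          using True hom
          by (simp add: orthonormal_product_same[OF r] orthonormal_product_same[OF r'])
      next
        case False
        have "X b \<in> Obj C" "X d \<in> Obj C" "Z \<in> Obj C"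
          using rh(1) k hom_obj by blast+
        then show ?thesis
          using False hom
          by (simp add: orthonormal_product_diff[OF r] orthonormal_product_diff[OF r'])
      qed
      also have "\<dots> = r' d \<cdot> ((r' b)\<^sup>\<star> \<cdot> (k \<cdot> (r b)\<^sup>\<star>))"
        using hom by simp
      finally show "r' d \<cdot> (m \<cdot> (r b)\<^sup>\<star>) = r' d \<cdot> ((r' b)\<^sup>\<star> \<cdot> (k \<cdot> (r b)\<^sup>\<star>))" .
    qed
    then have "(c \<cdot> m) \<cdot> (r b)\<^sup>\<star> = (c \<cdot> (r' b)\<^sup>\<star>) \<cdot> (k \<cdot> (r b)\<^sup>\<star>)"
      using hom by simp
    also have "\<dots> = k \<cdot> (r b)\<^sup>\<star>"
      unfolding c(2) using hom by simp
    finally show "(c \<cdot> m) \<cdot> (r b)\<^sup>\<star> = k \<cdot> (r b)\<^sup>\<star>" .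
  qed
  moreover have "(c \<cdot> m) \<cdot> h = c \<cdot> (m \<cdot> h)"
    by (rule Comp_assoc[OF h m(1) c(1)])
  ultimately show ?thesis
    by simp
qed

lemma add_mor_eqI:
  assumes r: "orthonormal_product C UNIV (\<lambda>_::bool. B) P r"
    and u: "u \<in> Hom C A P" "r True \<cdot> u = f" "r False \<cdot> u = g"
    and c: "c \<in> Hom C P B" "\<forall>b. c \<cdot> (r b)\<^sup>\<star> = Id C B"
  shows "f \<boxplus> g = c \<cdot> u"
proof -
  have hom: "f \<in> Hom C A B" "g \<in> Hom C A B"
    using Comp_in_Hom[OF u(1) orthonormal_product_hom[OF r UNIV_I, of True]]
      Comp_in_Hom[OF u(1) orthonormal_product_hom[OF r UNIV_I, of False]] u(2,3)
    by simp_all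
  then have f: "Dom C f = A" "Cod C f = B"
    by (simp_all add: Hom_def)
  have unique: "s = c \<cdot> u"
    if "orthonormal_product C UNIV (\<lambda>_::bool. B) P' r'"
      "u' \<in> Hom C A P'" "r' True \<cdot> u' = f" "r' False \<cdot> u' = g"
      "c' \<in> Hom C P' B" "\<forall>b. c' \<cdot> (r' b)\<^sup>\<star> = Id C B" "s = c' \<cdot> u'" for s P' r' u' c'
  proof -
    have "r' b \<cdot> u' = (c \<cdot> (r b)\<^sup>\<star>) \<cdot> (r b \<cdot> u)" for b
      unfolding c(2)[rule_format]
      by (cases b) (simp_all only: that u Id_Comp[OF hom(1)] Id_Comp[OF hom(2)])
    from pairing_codiagonal_eq_comp[OF r u(1) c(1) that(1,2) this that(5) that(6)[rule_format]]
    show ?thesis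
      using that(7) by simp
  qed
  show ?thesis
    unfolding plus_mor_def f
  proof (rule the_equality)
    show "\<exists>P r v d. orthonormal_product C UNIV (\<lambda>_::bool. B) P r
        \<and> v \<in> Hom C A P \<and> r True \<cdot> v = f \<and> r False \<cdot> v = g
        \<and> d \<in> Hom C P B \<and> (\<forall>b. d \<cdot> (r b)\<^sup>\<star> = Id C B) \<and> c \<cdot> u = d \<cdot> v"
      by (intro exI conjI) (rule r u c refl)+
  qed (elim exE conjE, rule unique)
qed

lemma binary_pairing:
  assumes r: "orthonormal_product C UNIV X P r"
    and f: "f \<in> Hom C Y (X True)" and g: "g \<in> Hom C Y (X False)"
  obtains u where "u \<in> Hom C Y P" "r True \<cdot> u = f" "r False \<cdot> u = g"
proof -
  have Y: "Y \<in> Obj C"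
    using f hom_obj by blast
  have "(if b then f else g) \<in> Hom C Y (X b)" for b
    using f g by (cases b) simp_all
  from ex1_implies_ex[OF orthonormal_product_ex1[OF r Y this]]
  obtain u where "u \<in> Hom C Y P" "\<forall>b\<in>UNIV. r b \<cdot> u = (if b then f else g)"
    by (elim exE conjE)
  then show ?thesis
    using that[of u] by simp
qed

lemma codiagonal:
  assumes r: "orthonormal_product C UNIV (\<lambda>_::bool. B) P r"
  obtains c where "c \<in> Hom C P B" "\<forall>b. c \<cdot> (r b)\<^sup>\<star> = Id C B"
proof -
  have B: "B \<in> Obj C"
    by (rule orthonormal_product_factor_obj[OF r UNIV_I])
  obtain d where d: "d \<in> Hom C B P" "r True \<cdot> d = Id C B" "r False \<cdot> d = Id C B"
    by (rule binary_pairing[OF r Id_in_Hom[OF B] Id_in_Hom[OF B]])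
  have "d\<^sup>\<star> \<cdot> (r b)\<^sup>\<star> = Id C B" for b
  proof -
    have "d\<^sup>\<star> \<cdot> (r b)\<^sup>\<star> = (r b \<cdot> d)\<^sup>\<star>"
      using d(1) orthonormal_product_hom[OF r UNIV_I, of b] by (simp add: Hom_def)
    also have "r b \<cdot> d = Id C B"
      using d(2,3) by (cases b) simp_all
    finally show ?thesis
      using B by simp
  qed
  then show ?thesis
    using that[OF Star_in_Hom[OF d(1)]] by blast
qed

text \<open>Each sum of parallel morphisms is a composite through any orthonormal product of their
  codomain with itself.\<close>

lemma add_mor_factors:
  assumes r: "orthonormal_product C UNIV (\<lambda>_::bool. B) P r"
    and f: "f \<in> Hom C A B" "g \<in> Hom C A B"
  obtains u c where "u \<in> Hom C A P" "r True \<cdot> u = f" "r False \<cdot> u = g"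
    "c \<in> Hom C P B" "\<forall>b. c \<cdot> (r b)\<^sup>\<star> = Id C B" "f \<boxplus> g = c \<cdot> u"
proof -
  obtain u where u: "u \<in> Hom C A P" "r True \<cdot> u = f" "r False \<cdot> u = g"
    by (rule binary_pairing[OF r f])
  obtain c where c: "c \<in> Hom C P B" "\<forall>b. c \<cdot> (r b)\<^sup>\<star> = Id C B"
    by (rule codiagonal[OF r])
  show ?thesis
    by (rule that[OF u c add_mor_eqI[OF r u c]])
qed

text \<open>Matrix multiplication of a row and a column; it gives the bilinearity of composition.\<close>

lemma comp_eq_add_mor:
  assumes r: "orthonormal_product C (UNIV::bool set) X P r"
    and h: "h \<in> Hom C Y P" and k: "k \<in> Hom C P Z"
  shows "k \<cdot> h = (k \<cdot> (r True)\<^sup>\<star>) \<cdot> (r True \<cdot> h) \<boxplus> (k \<cdot> (r False)\<^sup>\<star>) \<cdot> (r False \<cdot> h)"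
    (is "_ = ?f True \<boxplus> ?f False")
proof -
  have "Z \<in> Obj C" using k hom_obj by blast
  then obtain P' r' where r': "orthonormal_product C UNIV (\<lambda>_::bool. Z) P' r'"
    by (rule constant_pair_product)
  have f: "?f b \<in> Hom C Y Z" for b
    using h k orthonormal_product_hom[OF r UNIV_I, of b] by (simp_all add: Hom_def)
  obtain u c where u: "u \<in> Hom C Y P'" "r' True \<cdot> u = ?f True" "r' False \<cdot> u = ?f False"
    and c: "c \<in> Hom C P' Z" "\<forall>b. c \<cdot> (r' b)\<^sup>\<star> = Id C Z" and eq: "?f True \<boxplus> ?f False = c \<cdot> u"
    by (rule add_mor_factors[OF r' f[of True] f[of False]])
  have "r' b \<cdot> u = ?f b" for b
    using u by (cases b) auto
  then show ?thesis
    using pairing_codiagonal_eq_comp[OF r h k r' u(1) _ c(1) c(2)[rule_format]] eq by simp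
qed

lemma add_mor_in_Hom: "f \<in> Hom C A B \<Longrightarrow> g \<in> Hom C A B \<Longrightarrow> f \<boxplus> g \<in> Hom C A B"
proof -
  assume f: "f \<in> Hom C A B" "g \<in> Hom C A B"
  have "B \<in> Obj C"
    using f hom_obj by blast
  then obtain P r where r: "orthonormal_product C UNIV (\<lambda>_::bool. B) P r"
    by (rule constant_pair_product)
  show ?thesis
    by (rule add_mor_factors[OF r f]) (simp only: Comp_in_Hom)
qed

lemma comp_add_mor:
  assumes f: "f \<in> Hom C A B" "g \<in> Hom C A B" and l: "l \<in> Hom C B D"
  shows "l \<cdot> (f \<boxplus> g) = l \<cdot> f \<boxplus> l \<cdot> g"
proof -
  obtain P r where r: "orthonormal_product C UNIV (\<lambda>_::bool. B) P r"
    by (rule constant_pair_product[OF conjunct1[OF hom_obj[OF l]]])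
  obtain u c where u: "u \<in> Hom C A P" "r True \<cdot> u = f" "r False \<cdot> u = g"
    and c: "c \<in> Hom C P B" "\<forall>b. c \<cdot> (r b)\<^sup>\<star> = Id C B" and eq: "f \<boxplus> g = c \<cdot> u"
    by (rule add_mor_factors[OF r f])
  have lc: "l \<cdot> c \<in> Hom C P D"
    using l c Comp_in_Hom by blast
  have "(l \<cdot> c) \<cdot> (r b)\<^sup>\<star> = l" for b
    using l c orthonormal_product_hom[OF r UNIV_I, of b] by (simp_all add: Hom_def)
  then have "(l \<cdot> c) \<cdot> u = l \<cdot> f \<boxplus> l \<cdot> g"
    using comp_eq_add_mor[OF r u(1) lc] u by simp
  then show ?thesis
    unfolding eq using l c u by (simp_all add: Hom_def)
qed

lemma add_mor_comp:
  assumes f: "f \<in> Hom C A B" "g \<in> Hom C A B" and l: "l \<in> Hom C D A"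
  shows "(f \<boxplus> g) \<cdot> l = f \<cdot> l \<boxplus> g \<cdot> l"
proof -
  obtain P r where r: "orthonormal_product C UNIV (\<lambda>_::bool. B) P r"
    by (rule constant_pair_product[OF conjunct2[OF hom_obj[OF f(1)]]])
  obtain u c where u: "u \<in> Hom C A P" "r True \<cdot> u = f" "r False \<cdot> u = g"
    and c: "c \<in> Hom C P B" "\<forall>b. c \<cdot> (r b)\<^sup>\<star> = Id C B" and eq: "f \<boxplus> g = c \<cdot> u"
    by (rule add_mor_factors[OF r f])
  have "u \<cdot> l \<in> Hom C D P"
    using u l Comp_in_Hom by blast
  moreover have "r True \<cdot> (u \<cdot> l) = f \<cdot> l" "r False \<cdot> (u \<cdot> l) = g \<cdot> l"
    unfolding u(2,3)[symmetric]
    using Comp_assoc[OF l u(1) orthonormal_product_hom[OF r UNIV_I]] by simp_all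
  ultimately have "f \<cdot> l \<boxplus> g \<cdot> l = c \<cdot> (u \<cdot> l)"
    using add_mor_eqI[OF r] c by blast
  then show ?thesis
    unfolding eq using l c u by (simp_all add: Hom_def)
qed

lemma add_mor_commute:
  assumes f: "f \<in> Hom C A B" "g \<in> Hom C A B"
  shows "f \<boxplus> g = g \<boxplus> f"
proof -
  obtain P r where r: "orthonormal_product C UNIV (\<lambda>_::bool. B) P r"
    by (rule constant_pair_product[OF conjunct2[OF hom_obj[OF f(1)]]])
  obtain u c where u: "u \<in> Hom C A P" "r True \<cdot> u = f" "r False \<cdot> u = g"
    and c: "c \<in> Hom C P B" "\<forall>b. c \<cdot> (r b)\<^sup>\<star> = Id C B" and eq: "f \<boxplus> g = c \<cdot> u"
    by (rule add_mor_factors[OF r f])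
  obtain u' c' where u': "u' \<in> Hom C A P" "r True \<cdot> u' = g" "r False \<cdot> u' = f"
    and c': "c' \<in> Hom C P B" "\<forall>b. c' \<cdot> (r b)\<^sup>\<star> = Id C B" and eq': "g \<boxplus> f = c' \<cdot> u'"
    by (rule add_mor_factors[OF r f(2,1)])
  \<comment> \<open>exchanging the two projections gives another orthonormal product\<close>
  have hom: "r b \<in> Hom C P B" for b
    using orthonormal_product_hom[OF r] by simp
  have swap: "orthonormal_product C UNIV (\<lambda>_::bool. B) P (\<lambda>b. r (\<not> b))"
    unfolding orthonormal_product_def is_product_def
  proof (intro conjI ballI allI impI)
    fix Y and h :: "bool \<Rightarrow> _"
    assume Y: "Y \<in> Obj C" and h: "\<forall>b\<in>UNIV. h b \<in> Hom C Y B"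
    obtain x where x: "x \<in> Hom C Y P" "r True \<cdot> x = h False" "r False \<cdot> x = h True"
      by (rule binary_pairing[OF r bspec[OF h UNIV_I] bspec[OF h UNIV_I]])
    have xb: "r (\<not> b) \<cdot> x = h b" for b
      using x(2,3) by (cases b) simp_all
    show "\<exists>!x. x \<in> Hom C Y P \<and> (\<forall>b\<in>UNIV. r (\<not> b) \<cdot> x = h b)"
    proof (rule ex1I[of _ x])
      fix y
      assume y: "y \<in> Hom C Y P \<and> (\<forall>b\<in>UNIV. r (\<not> b) \<cdot> y = h b)"
      then have "r b \<cdot> y = r b \<cdot> x" for b
        using x(2,3) by (cases b) (simp_all add: all_bool_eq)
      then show "y = x"
        using orthonormal_product_eqI[OF r conjunct1[OF y] x(1)] by blast
    qed (simp add: x(1) xb)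
  next
    show "coisometry C (r (\<not> b))" for b
      using r by (simp add: orthonormal_product_def)
    show "r (\<not> b) \<cdot> (r (\<not> d))\<^sup>\<star> = zero_mor C B B" if "b \<noteq> d" for b d
      by (rule orthonormal_product_diff[OF r UNIV_I UNIV_I]) (use that in simp)
  qed (simp_all add: hom orthonormal_product_obj[OF r])
  have "g \<boxplus> f = c \<cdot> u"
    by (rule add_mor_eqI[OF swap u(1) _ _ c(1)]) (use u c in auto)
  then show ?thesis
    using eq by simp
qed

lemma add_mor_zero:
  assumes f: "f \<in> Hom C A B"
  shows "f \<boxplus> zero_mor C A B = f"
proof -
  have AB: "A \<in> Obj C" "B \<in> Obj C"
    using f hom_obj by blast+
  obtain P r where r: "orthonormal_product C UNIV (\<lambda>_::bool. B) P r"
    by (rule constant_pair_product[OF conjunct2[OF hom_obj[OF f]]])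
  obtain c where c: "c \<in> Hom C P B" "\<forall>b. c \<cdot> (r b)\<^sup>\<star> = Id C B"
    by (rule codiagonal[OF r])
  have hom: "r b \<in> Arr C" "Dom C (r b) = P" "Cod C (r b) = B" for b
    using orthonormal_product_hom[OF r UNIV_I, of b] by (simp_all add: Hom_def)
  have "(r True)\<^sup>\<star> \<cdot> f \<in> Hom C A P"
    using hom f by (simp_all add: Hom_def)
  moreover have "r b \<cdot> ((r True)\<^sup>\<star> \<cdot> f) = (r b \<cdot> (r True)\<^sup>\<star>) \<cdot> f" for b
    using hom f by (simp_all add: Hom_def)
  then have "r True \<cdot> ((r True)\<^sup>\<star> \<cdot> f) = f" "r False \<cdot> ((r True)\<^sup>\<star> \<cdot> f) = zero_mor C A B"
    using f AB by (simp_all add: Hom_def orthonormal_product_same[OF r] orthonormal_product_diff[OF r])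
  ultimately have "f \<boxplus> zero_mor C A B = c \<cdot> ((r True)\<^sup>\<star> \<cdot> f)"
    using add_mor_eqI[OF r] c by blast
  also have "\<dots> = (c \<cdot> (r True)\<^sup>\<star>) \<cdot> f"
    using hom c(1) f by (simp add: Hom_def)
  finally show ?thesis
    using c(2) f by (simp_all add: Hom_def)
qed

text \<open>The interchange law of the Eckmann-Hilton argument, from which associativity follows.\<close>

lemma add_mor_interchange:
  assumes f: "f \<in> Hom C A B" "g \<in> Hom C A B" "h \<in> Hom C A B" "k \<in> Hom C A B"
  shows "(f \<boxplus> g) \<boxplus> (h \<boxplus> k) = (f \<boxplus> h) \<boxplus> (g \<boxplus> k)"
proof -
  obtain P r where r: "orthonormal_product C UNIV (\<lambda>_::bool. B) P r"
    by (rule constant_pair_product[OF conjunct2[OF hom_obj[OF f(1)]]])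
  note hom = orthonormal_product_hom[OF r UNIV_I]
  obtain u c where u: "u \<in> Hom C A P" "r True \<cdot> u = f" "r False \<cdot> u = h"
    and c: "c \<in> Hom C P B" "\<forall>b. c \<cdot> (r b)\<^sup>\<star> = Id C B" and eq: "f \<boxplus> h = c \<cdot> u"
    by (rule add_mor_factors[OF r f(1,3)])
  obtain v d where v: "v \<in> Hom C A P" "r True \<cdot> v = g" "r False \<cdot> v = k"
    by (rule add_mor_factors[OF r f(2,4)])
  have "(f \<boxplus> g) \<boxplus> (h \<boxplus> k) = c \<cdot> (u \<boxplus> v)"
    by (rule add_mor_eqI[OF r add_mor_in_Hom[OF u(1) v(1)] _ _ c])
      (simp_all add: comp_add_mor[OF u(1) v(1) hom] u v)
  also have "\<dots> = c \<cdot> u \<boxplus> c \<cdot> v"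
    by (rule comp_add_mor[OF u(1) v(1) c(1)])
  also have "c \<cdot> v = g \<boxplus> k"
    by (rule add_mor_eqI[OF r v c, symmetric])
  finally show ?thesis
    using eq by simp
qed

lemma add_mor_assoc:
  assumes f: "f \<in> Hom C A B" "g \<in> Hom C A B" "h \<in> Hom C A B"
  shows "(f \<boxplus> g) \<boxplus> h = f \<boxplus> (g \<boxplus> h)"
proof -
  have z: "zero_mor C A B \<in> Hom C A B"
    using f hom_obj zero_mor_in_Hom by blast
  have "zero_mor C A B \<boxplus> h = h"
    using add_mor_commute[OF z f(3)] add_mor_zero[OF f(3)] by simp
  then show ?thesis
    using add_mor_interchange[OF f(1,2) z f(3)] add_mor_zero[OF f(1)] by simp
qed

lemma star_add_mor:
  assumes f: "f \<in> Hom C A B" "g \<in> Hom C A B"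
  shows "(f \<boxplus> g)\<^sup>\<star> = f\<^sup>\<star> \<boxplus> g\<^sup>\<star>"
proof -
  obtain P r where r: "orthonormal_product C UNIV (\<lambda>_::bool. B) P r"
    by (rule constant_pair_product[OF conjunct2[OF hom_obj[OF f(1)]]])
  obtain u c where u: "u \<in> Hom C A P" "r True \<cdot> u = f" "r False \<cdot> u = g"
    and c: "c \<in> Hom C P B" "\<forall>b. c \<cdot> (r b)\<^sup>\<star> = Id C B" and eq: "f \<boxplus> g = c \<cdot> u"
    by (rule add_mor_factors[OF r f])
  have B: "B \<in> Obj C"
    using f(1) hom_obj by blast
  have hom: "r b \<in> Hom C P B" for b
    using orthonormal_product_hom[OF r] by simp
  have c': "r b \<cdot> c\<^sup>\<star> = Id C B" for b
  proof -
    have "r b \<cdot> c\<^sup>\<star> = (c \<cdot> (r b)\<^sup>\<star>)\<^sup>\<star>"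
      using hom[of b] c(1) by (simp add: Hom_def)
    then show ?thesis
      using c(2) B by simp
  qed
  have u': "u\<^sup>\<star> \<cdot> (r b)\<^sup>\<star> = (r b \<cdot> u)\<^sup>\<star>" for b
    using hom[of b] u(1) by (simp add: Hom_def)
  have "(f \<boxplus> g)\<^sup>\<star> = u\<^sup>\<star> \<cdot> c\<^sup>\<star>"
    unfolding eq by (rule Star_Comp[OF u(1) c(1)])
  also have "\<dots> = f\<^sup>\<star> \<cdot> Id C B \<boxplus> g\<^sup>\<star> \<cdot> Id C B"
    using comp_eq_add_mor[OF r Star_in_Hom[OF c(1)] Star_in_Hom[OF u(1)]]
    by (simp add: c' u' u(2,3))
  finally show ?thesis
    using f by (simp add: Hom_def)
qed

lemma zero_mor_add: "f \<in> Hom C A B \<Longrightarrow> zero_mor C A B \<boxplus> f = f"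
  using add_mor_commute[of "zero_mor C A B" A B f] add_mor_zero[of f A B] zero_mor_in_Hom[of A B]
    hom_obj[of f A B] by simp


section \<open>Additive inverses\<close>

lemma kernel_factor:
  assumes k: "is_kernel C f k" and t: "t \<in> Hom C Y (Dom C f)" "f \<cdot> t = zero_mor C Y (Cod C f)"
  obtains s where "s \<in> Hom C Y (Dom C k)" "k \<cdot> s = t"
proof -
  have t': "t \<in> Arr C" "Dom C t = Y" "Cod C t = Dom C f"
    using t(1) by (simp_all add: Hom_def)
  have "\<forall>t \<in> Arr C. Cod C t = Dom C f \<and> f \<cdot> t = zero_mor C (Dom C t) (Cod C f)
      \<longrightarrow> (\<exists>!s. s \<in> Hom C (Dom C t) (Dom C k) \<and> k \<cdot> s = t)"
    using k unfolding is_kernel_def by (elim conjE)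
  from bspec[OF this t'(1)] have "\<exists>!s. s \<in> Hom C Y (Dom C k) \<and> k \<cdot> s = t"
    using t(2) t' by simp
  then show ?thesis
    by (elim ex1E conjE) (rule that)
qed

text \<open>Let \<open>k = (u, v)\<close> be a kernel of the codiagonal \<open>d\<^sup>\<star>\<close>. The diagonal \<open>d\<close> is itself a kernel of some
  \<open>f\<close>, and \<open>f\<close> factors through \<open>k\<^sup>\<star>\<close>. So if \<open>u\<^sup>\<star> \<cdot> t = 0\<close>, then \<open>f\<close> kills \<open>(t, 0)\<close>, which therefore
  factors through the diagonal, and \<open>t = 0\<close>.\<close>

lemma component_of_codiagonal_kernel_reflects_zero:
  assumes A: "A \<in> Obj C" and r: "orthonormal_product C UNIV (\<lambda>_::bool. A) P r"
    and d: "d \<in> Hom C A P" "\<And>b. r b \<cdot> d = Id C A"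
    and k: "is_kernel C (d\<^sup>\<star>) k"
    and t: "t \<in> Hom C Y A" "(r True \<cdot> k)\<^sup>\<star> \<cdot> t = zero_mor C Y (Dom C k)"
  shows "t = zero_mor C Y A"
proof -
  have P: "P \<in> Obj C" and Y: "Y \<in> Obj C"
    using d t hom_obj by blast+
  note rh = orthonormal_product_hom[OF r UNIV_I]
  have "\<forall>b. r b \<cdot> d = Id C A"
    using d(2) by simp
  then obtain f where f: "is_kernel C f d"
    using diagonal_kernel[OF A r d(1)] by blast
  then have f': "f \<in> Arr C" "Dom C f = P" "f \<cdot> d = zero_mor C A (Cod C f)"
    using d(1) unfolding is_kernel_def by (simp_all add: Hom_def)
  have k': "k \<in> Arr C" "Cod C k = P"
    using k d(1) unfolding is_kernel_def by (simp_all add: Hom_def)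
  note typing = d(1)[unfolded Hom_def] t(1)[unfolded Hom_def] rh[unfolded Hom_def] f'(1,2) k'
  \<comment> \<open>the adjoint of \<open>f\<close> factors through the kernel of the codiagonal\<close>
  have "d\<^sup>\<star> \<cdot> f\<^sup>\<star> = (f \<cdot> d)\<^sup>\<star>"
    using typing by simp
  also have "\<dots> = zero_mor C (Cod C f) A"
    unfolding f'(3) using A f' by simp
  finally have zero: "d\<^sup>\<star> \<cdot> f\<^sup>\<star> = zero_mor C (Cod C f) A" .
  obtain s where s: "s \<in> Hom C (Cod C f) (Dom C k)" "k \<cdot> s = f\<^sup>\<star>"
    by (rule kernel_factor[OF k, of "f\<^sup>\<star>" "Cod C f"]) (use typing zero in \<open>simp_all add: Hom_def\<close>)
  have "f = (k \<cdot> s)\<^sup>\<star>"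
    using s(2) f' by simp
  then have fs: "f = s\<^sup>\<star> \<cdot> k\<^sup>\<star>"
    using s(1) k' by (simp add: Hom_def)
  have "f \<cdot> ((r True)\<^sup>\<star> \<cdot> t) = s\<^sup>\<star> \<cdot> ((r True \<cdot> k)\<^sup>\<star> \<cdot> t)"
    unfolding fs using s(1) typing by (simp add: Hom_def)
  also have "\<dots> = zero_mor C Y (Cod C f)"
    unfolding t(2) using s(1) Y by (simp add: Hom_def)
  finally have zero': "f \<cdot> ((r True)\<^sup>\<star> \<cdot> t) = zero_mor C Y (Cod C f)" .
  obtain x where "x \<in> Hom C Y (Dom C d)" and dx: "d \<cdot> x = (r True)\<^sup>\<star> \<cdot> t"
    by (rule kernel_factor[OF f, of "(r True)\<^sup>\<star> \<cdot> t" Y])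
      (use typing zero' in \<open>simp_all add: Hom_def\<close>)
  then have x: "x \<in> Hom C Y A"
    using typing by simp
  have rx: "r b \<cdot> ((r True)\<^sup>\<star> \<cdot> t) = x" for b
  proof -
    have "r b \<cdot> (d \<cdot> x) = (r b \<cdot> d) \<cdot> x"
      by (rule Comp_assoc[OF x d(1) rh, symmetric])
    then show ?thesis
      unfolding dx d(2) using Id_Comp[OF x] by simp
  qed
  have assoc: "r b \<cdot> ((r True)\<^sup>\<star> \<cdot> t) = (r b \<cdot> (r True)\<^sup>\<star>) \<cdot> t" for b
    by (rule Comp_assoc[OF t(1) Star_in_Hom[OF rh] rh, symmetric])
  have "x = zero_mor C Y A"
    using rx[of False] assoc[of False] orthonormal_product_diff[OF r UNIV_I UNIV_I, of False True]
      t(1) A by (simp add: Hom_def)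
  moreover have "x = t"
    using rx[of True] assoc[of True] orthonormal_product_same[OF r UNIV_I, of True] Id_Comp[OF t(1)]
    by simp
  ultimately show ?thesis
    by simp
qed

text \<open>With \<open>(u, v)\<close> an isometric kernel of the codiagonal, the inverse of \<open>1\<close> is twice \<open>v \<cdot> u\<^sup>\<star>\<close>.\<close>

lemma id_has_additive_inverse:
  assumes A: "A \<in> Obj C"
  obtains n where "n \<in> Hom C A A" "Id C A \<boxplus> n = zero_mor C A A"
proof -
  obtain P r where r: "orthonormal_product C UNIV (\<lambda>_::bool. A) P r"
    by (rule constant_pair_product[OF A])
  obtain e where e: "e \<in> Hom C P A" "\<forall>b. e \<cdot> (r b)\<^sup>\<star> = Id C A"
    by (rule codiagonal[OF r])
  note rh = orthonormal_product_hom[OF r UNIV_I]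
  have "e \<in> Arr C"
    using e(1) by (simp add: Hom_def)
  then obtain k where k: "is_kernel C e k" "isometry C k"
    using isometric_kernels by blast
  define K where "K = Dom C k"
  have k': "k \<in> Hom C K P" "e \<cdot> k = zero_mor C K A" "k\<^sup>\<star> \<cdot> k = Id C K"
    using k e(1) unfolding is_kernel_def isometry_def K_def by (simp_all add: Hom_def)
  have K: "K \<in> Obj C"
    using k'(1) hom_obj by blast
  define u v where "u = r True \<cdot> k" and "v = r False \<cdot> k"
  have uv: "u \<in> Hom C K A" "v \<in> Hom C K A"
    unfolding u_def v_def by (rule Comp_in_Hom[OF k'(1) rh])+
  note uv' = uv[THEN Star_in_Hom]
  have sum: "u \<boxplus> v = zero_mor C K A"
    using comp_eq_add_mor[OF r k'(1) e(1)] e(2) k'(2) Id_Comp[OF uv(1)] Id_Comp[OF uv(2)]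
    by (simp add: u_def v_def)
  have "k\<^sup>\<star> \<cdot> (r b)\<^sup>\<star> = (r b \<cdot> k)\<^sup>\<star>" for b
    by (rule Star_Comp[OF k'(1) rh, symmetric])
  then have one: "u\<^sup>\<star> \<cdot> u \<boxplus> v\<^sup>\<star> \<cdot> v = Id C K"
    using comp_eq_add_mor[OF r k'(1) Star_in_Hom[OF k'(1)]] k'(3) by (simp add: u_def v_def)
  note hom = Comp_in_Hom[OF uv(1) uv'(1)] Comp_in_Hom[OF uv(2) uv'(1)]
    Comp_in_Hom[OF uv(1) uv'(2)] Comp_in_Hom[OF uv(2) uv'(2)]
  have uu_uv: "u\<^sup>\<star> \<cdot> u \<boxplus> u\<^sup>\<star> \<cdot> v = zero_mor C K K"
    using comp_add_mor[OF uv uv'(1)] uv' K by (simp add: sum Hom_def)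
  have vu_vv: "v\<^sup>\<star> \<cdot> u \<boxplus> v\<^sup>\<star> \<cdot> v = zero_mor C K K"
    using comp_add_mor[OF uv uv'(2)] uv' K by (simp add: sum Hom_def)
  have "u\<^sup>\<star> \<boxplus> v\<^sup>\<star> = zero_mor C A K"
    using star_add_mor[OF uv] K A by (simp add: sum)
  then have uu_vu: "u\<^sup>\<star> \<cdot> u \<boxplus> v\<^sup>\<star> \<cdot> u = zero_mor C K K"
    using add_mor_comp[OF uv' uv(1)] uv(1) K by (simp add: Hom_def)
  have "v\<^sup>\<star> \<cdot> u = v\<^sup>\<star> \<cdot> u \<boxplus> (u\<^sup>\<star> \<cdot> u \<boxplus> u\<^sup>\<star> \<cdot> v)"
    unfolding uu_uv by (rule add_mor_zero[OF hom(3), symmetric])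
  also have "\<dots> = (u\<^sup>\<star> \<cdot> u \<boxplus> v\<^sup>\<star> \<cdot> u) \<boxplus> u\<^sup>\<star> \<cdot> v"
    using add_mor_assoc[OF hom(3,1,2)] add_mor_commute[OF hom(3,1)] by simp
  also have "\<dots> = u\<^sup>\<star> \<cdot> v"
    unfolding uu_vu by (rule zero_mor_add[OF hom(2)])
  finally have vu_eq_uv: "v\<^sup>\<star> \<cdot> u = u\<^sup>\<star> \<cdot> v" .
  have "(u\<^sup>\<star> \<cdot> u \<boxplus> v\<^sup>\<star> \<cdot> v) \<boxplus> (u\<^sup>\<star> \<cdot> v \<boxplus> u\<^sup>\<star> \<cdot> v)
      = (u\<^sup>\<star> \<cdot> u \<boxplus> u\<^sup>\<star> \<cdot> v) \<boxplus> (v\<^sup>\<star> \<cdot> v \<boxplus> u\<^sup>\<star> \<cdot> v)"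
    by (rule add_mor_interchange[OF hom(1,4,2,2)])
  also have "v\<^sup>\<star> \<cdot> v \<boxplus> u\<^sup>\<star> \<cdot> v = zero_mor C K K"
    using add_mor_commute[OF hom(4,3)] vu_vv vu_eq_uv by simp
  finally have one_plus: "Id C K \<boxplus> (u\<^sup>\<star> \<cdot> v \<boxplus> u\<^sup>\<star> \<cdot> v) = zero_mor C K K"
    using add_mor_zero[OF zero_mor_in_Hom[OF K K]] by (simp add: one uu_uv)

  let ?m = "v \<cdot> u\<^sup>\<star>"
  have m: "?m \<in> Hom C A A"
    by (rule Comp_in_Hom[OF uv'(1) uv(2)])
  have mm: "?m \<boxplus> ?m \<in> Hom C A A"
    by (rule add_mor_in_Hom[OF m m])
  have um: "u\<^sup>\<star> \<cdot> ?m = (u\<^sup>\<star> \<cdot> v) \<cdot> u\<^sup>\<star>"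
    by (rule Comp_assoc[OF uv'(1) uv(2) uv'(1), symmetric])
  have "u\<^sup>\<star> \<cdot> (Id C A \<boxplus> (?m \<boxplus> ?m)) = u\<^sup>\<star> \<cdot> Id C A \<boxplus> (u\<^sup>\<star> \<cdot> ?m \<boxplus> u\<^sup>\<star> \<cdot> ?m)"
    using comp_add_mor[OF Id_in_Hom[OF A] mm uv'(1)] comp_add_mor[OF m m uv'(1)] by simp
  also have "\<dots> = Id C K \<cdot> u\<^sup>\<star> \<boxplus> (u\<^sup>\<star> \<cdot> v \<boxplus> u\<^sup>\<star> \<cdot> v) \<cdot> u\<^sup>\<star>"
    using add_mor_comp[OF hom(2,2) uv'(1)] Comp_Id[OF uv'(1)] Id_Comp[OF uv'(1)] um by simp
  also have "\<dots> = (Id C K \<boxplus> (u\<^sup>\<star> \<cdot> v \<boxplus> u\<^sup>\<star> \<cdot> v)) \<cdot> u\<^sup>\<star>"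
    by (rule add_mor_comp[OF Id_in_Hom[OF K] add_mor_in_Hom[OF hom(2,2)] uv'(1), symmetric])
  also have "\<dots> = zero_mor C A K"
    unfolding one_plus using uv'(1) K by (simp add: Hom_def)
  finally have "u\<^sup>\<star> \<cdot> (Id C A \<boxplus> (?m \<boxplus> ?m)) = zero_mor C A K" .
  moreover have "r b \<cdot> e\<^sup>\<star> = Id C A" for b
  proof -
    have "r b \<cdot> e\<^sup>\<star> = (e \<cdot> (r b)\<^sup>\<star>)\<^sup>\<star>"
      using rh[of b] e(1) by (simp add: Hom_def)
    then show ?thesis
      using e(2) A by simp
  qed
  moreover have "(e\<^sup>\<star>)\<^sup>\<star> = e"
    using e(1) by (simp add: Hom_def)
  ultimately have "Id C A \<boxplus> (?m \<boxplus> ?m) = zero_mor C A A"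
    using component_of_codiagonal_kernel_reflects_zero[OF A r Star_in_Hom[OF e(1)] _ _
        add_mor_in_Hom[OF Id_in_Hom[OF A] mm]] k(1)
    by (simp add: u_def K_def)
  then show ?thesis
    by (rule that[OF mm])
qed


section \<open>The groups of morphisms and finite orthonormal products\<close>

text \<open>The additive group of morphisms from \<open>A\<close> to \<open>B\<close>. Only its additive part is meaningful in general;
  the multiplicative fields are filled so that the case \<open>A = B\<close> is the endomorphism ring.\<close>

definition hom_group :: "'a \<Rightarrow> 'a \<Rightarrow> 'b ring" where
  "hom_group A B = \<lparr>carrier = Hom C A B, mult = Comp C, one = Id C A,
     zero = zero_mor C A B, add = plus_mor C\<rparr>"

lemma End_eq_hom_group: "End C A = hom_group A A"
  by (simp add: End_def hom_group_def)

lemma hom_group_abelian: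
  assumes A: "A \<in> Obj C" and B: "B \<in> Obj C"
  shows "abelian_group (hom_group A B)"
proof (rule abelian_groupI)
  fix f
  assume f: "f \<in> carrier (hom_group A B)"
  obtain n where n: "n \<in> Hom C B B" "Id C B \<boxplus> n = zero_mor C B B"
    by (rule id_has_additive_inverse[OF B])
  have fn: "f \<in> Hom C A B" "n \<cdot> f \<in> Hom C A B"
    using f Comp_in_Hom[OF _ n(1)] by (simp_all add: hom_group_def)
  have "f \<boxplus> n \<cdot> f = zero_mor C A B"
    using add_mor_comp[OF Id_in_Hom[OF B] n(1) fn(1)] fn(1) B by (simp add: n(2) Hom_def)
  then have "n \<cdot> f \<boxplus> f = zero_mor C A B"
    using add_mor_commute[OF fn] by simp
  then show "\<exists>y\<in>carrier (hom_group A B). y \<oplus>\<^bsub>hom_group A B\<^esub> f = \<zero>\<^bsub>hom_group A B\<^esub>"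
    using fn(2) by (intro bexI[of _ "n \<cdot> f"]) (simp_all add: hom_group_def)
next
  fix f g h
  assume "f \<in> carrier (hom_group A B)" "g \<in> carrier (hom_group A B)" "h \<in> carrier (hom_group A B)"
  then show "f \<oplus>\<^bsub>hom_group A B\<^esub> g \<oplus>\<^bsub>hom_group A B\<^esub> h
      = f \<oplus>\<^bsub>hom_group A B\<^esub> (g \<oplus>\<^bsub>hom_group A B\<^esub> h)"
    using add_mor_assoc by (simp add: hom_group_def)
next
  fix f g
  assume fg: "f \<in> carrier (hom_group A B)" "g \<in> carrier (hom_group A B)"
  then show "f \<oplus>\<^bsub>hom_group A B\<^esub> g \<in> carrier (hom_group A B)"
    by (simp add: hom_group_def add_mor_in_Hom)
  show "f \<oplus>\<^bsub>hom_group A B\<^esub> g = g \<oplus>\<^bsub>hom_group A B\<^esub> f"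
    using fg add_mor_commute[of f A B g] by (simp add: hom_group_def)
qed (use zero_mor_in_Hom[OF A B] zero_mor_add in \<open>simp_all add: hom_group_def\<close>)

lemma comp_finsum:
  assumes "finite F" and "f \<in> F \<rightarrow> Hom C A B" and l: "l \<in> Hom C B D" and A: "A \<in> Obj C"
  shows "l \<cdot> finsum (hom_group A B) f F = finsum (hom_group A D) (\<lambda>j. l \<cdot> f j) F"
  using assms(1,2)
proof (induction F)
  case empty
  have "B \<in> Obj C" "D \<in> Obj C"
    using l hom_obj by blast+
  then interpret AB: abelian_group "hom_group A B" + AD: abelian_group "hom_group A D"
    using hom_group_abelian A by simp_all
  show ?case
    using l A by (simp add: AB.finsum_empty AD.finsum_empty) (simp add: hom_group_def Hom_def)
next
  case (insert j F)
  have "B \<in> Obj C" "D \<in> Obj C"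
    using l hom_obj by blast+
  then interpret AB: abelian_group "hom_group A B" + AD: abelian_group "hom_group A D"
    using hom_group_abelian A by simp_all
  have carrier: "carrier (hom_group A B) = Hom C A B" "carrier (hom_group A D) = Hom C A D"
    by (simp_all add: hom_group_def)
  have f: "f \<in> F \<rightarrow> Hom C A B" "f j \<in> Hom C A B"
    using insert.prems by auto
  then have lf: "(\<lambda>j. l \<cdot> f j) \<in> F \<rightarrow> Hom C A D" "l \<cdot> f j \<in> Hom C A D"
    using Comp_in_Hom[OF _ l] by (simp_all add: Pi_iff)
  have sum: "finsum (hom_group A B) f F \<in> Hom C A B"
    using AB.finsum_closed[of f F] f by (simp add: carrier)
  have "finsum (hom_group A B) f (insert j F) = f j \<boxplus> finsum (hom_group A B) f F"
    using AB.finsum_insert[of F j f] insert.hyps f by (simp add: carrier) (simp add: hom_group_def)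
  moreover have "finsum (hom_group A D) (\<lambda>j. l \<cdot> f j) (insert j F)
      = l \<cdot> f j \<boxplus> finsum (hom_group A D) (\<lambda>j. l \<cdot> f j) F"
    using AD.finsum_insert[of F j "\<lambda>j. l \<cdot> f j"] insert.hyps lf
    by (simp add: carrier) (simp add: hom_group_def)
  ultimately show ?case
    using comp_add_mor[OF f(2) sum l] insert.IH[OF f(1)] by simp
qed

text \<open>For \<open>h = 1\<close> this is the resolution of the identity \<open>1 = \<Sum>j. (r j)\<^sup>\<star> \<cdot> r j\<close>. Both sides have the
  same components.\<close>

lemma orthonormal_product_expansion:
  assumes r: "orthonormal_product C F X P r" and h: "h \<in> Hom C Y P"
  shows "h = finsum (hom_group Y P) (\<lambda>j. (r j)\<^sup>\<star> \<cdot> (r j \<cdot> h)) F"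
proof (rule orthonormal_product_eqI[OF r h])
  have Y: "Y \<in> Obj C" and P: "P \<in> Obj C"
    using h hom_obj by blast+
  interpret YP: abelian_group "hom_group Y P"
    by (rule hom_group_abelian[OF Y P])
  have fin: "finite F"
    using r unfolding orthonormal_product_def by (elim conjE)
  note rh = orthonormal_product_hom[OF r]
  have rhh: "r j \<cdot> h \<in> Hom C Y (X j)" if "j \<in> F" for j
    by (rule Comp_in_Hom[OF h rh[OF that]])
  have summands: "(\<lambda>j. (r j)\<^sup>\<star> \<cdot> (r j \<cdot> h)) \<in> F \<rightarrow> Hom C Y P"
    using Comp_in_Hom[OF rhh Star_in_Hom[OF rh]] by blast
  then show "finsum (hom_group Y P) (\<lambda>j. (r j)\<^sup>\<star> \<cdot> (r j \<cdot> h)) F \<in> Hom C Y P"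
    using YP.finsum_closed[of "\<lambda>j. (r j)\<^sup>\<star> \<cdot> (r j \<cdot> h)" F] by (simp add: hom_group_def)
  fix k
  assume k: "k \<in> F"
  have Xk: "X k \<in> Obj C"
    by (rule orthonormal_product_factor_obj[OF r k])
  interpret Yk: abelian_group "hom_group Y (X k)"
    by (rule hom_group_abelian[OF Y Xk])
  have "r k \<cdot> finsum (hom_group Y P) (\<lambda>j. (r j)\<^sup>\<star> \<cdot> (r j \<cdot> h)) F
      = finsum (hom_group Y (X k)) (\<lambda>j. r k \<cdot> ((r j)\<^sup>\<star> \<cdot> (r j \<cdot> h))) F"
    by (rule comp_finsum[OF fin summands rh[OF k] Y])
  also have "\<dots> = finsum (hom_group Y (X k))
      (\<lambda>j. if k = j then r k \<cdot> h else \<zero>\<^bsub>hom_group Y (X k)\<^esub>) F"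
  proof (rule Yk.finsum_cong')
    show "(\<lambda>j. if k = j then r k \<cdot> h else \<zero>\<^bsub>hom_group Y (X k)\<^esub>) \<in> F \<rightarrow> carrier (hom_group Y (X k))"
      using rhh[OF k] zero_mor_in_Hom[OF Y Xk] by (simp add: hom_group_def Pi_iff)
    fix j
    assume j: "j \<in> F"
    have "r k \<cdot> ((r j)\<^sup>\<star> \<cdot> (r j \<cdot> h)) = (r k \<cdot> (r j)\<^sup>\<star>) \<cdot> (r j \<cdot> h)"
      by (rule Comp_assoc[OF rhh[OF j] Star_in_Hom[OF rh[OF j]] rh[OF k], symmetric])
    also have "\<dots> = (if k = j then r k \<cdot> h else \<zero>\<^bsub>hom_group Y (X k)\<^esub>)"
    proof (cases "k = j")
      case True
      then show ?thesis
        using orthonormal_product_same[OF r k] Id_Comp[OF rhh[OF k]] by simp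
    next
      case False
      then show ?thesis
        using orthonormal_product_diff[OF r k j False] rhh[OF j] Xk
        by (simp add: hom_group_def Hom_def)
    qed
    finally show "r k \<cdot> ((r j)\<^sup>\<star> \<cdot> (r j \<cdot> h))
        = (if k = j then r k \<cdot> h else \<zero>\<^bsub>hom_group Y (X k)\<^esub>)" .
  qed simp
  also have "\<dots> = r k \<cdot> h"
    by (rule Yk.finsum_singleton[OF k fin]) (simp add: hom_group_def rhh[OF k])
  finally show "r k \<cdot> h = r k \<cdot> finsum (hom_group Y P) (\<lambda>j. (r j)\<^sup>\<star> \<cdot> (r j \<cdot> h)) F"
    by simp
qed

text \<open>Parseval's identity.\<close>

lemma star_comp_eq_finsum:
  assumes r: "orthonormal_product C F X P r" and h: "h \<in> Hom C Y P"
  shows "h\<^sup>\<star> \<cdot> h = finsum (End C Y) (\<lambda>j. (r j \<cdot> h)\<^sup>\<star> \<cdot> (r j \<cdot> h)) F"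
proof -
  have Y: "Y \<in> Obj C"
    using h hom_obj by blast
  interpret YY: abelian_group "hom_group Y Y"
    by (rule hom_group_abelian[OF Y Y])
  have fin: "finite F"
    using r unfolding orthonormal_product_def by (elim conjE)
  note rh = orthonormal_product_hom[OF r]
  have rhh: "r j \<cdot> h \<in> Hom C Y (X j)" if "j \<in> F" for j
    by (rule Comp_in_Hom[OF h rh[OF that]])
  have "(\<lambda>j. (r j)\<^sup>\<star> \<cdot> (r j \<cdot> h)) \<in> F \<rightarrow> Hom C Y P"
    using Comp_in_Hom[OF rhh Star_in_Hom[OF rh]] by blast
  then have "h\<^sup>\<star> \<cdot> finsum (hom_group Y P) (\<lambda>j. (r j)\<^sup>\<star> \<cdot> (r j \<cdot> h)) F
      = finsum (hom_group Y Y) (\<lambda>j. h\<^sup>\<star> \<cdot> ((r j)\<^sup>\<star> \<cdot> (r j \<cdot> h))) F"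
    by (rule comp_finsum[OF fin _ Star_in_Hom[OF h] Y])
  also have "\<dots> = finsum (hom_group Y Y) (\<lambda>j. (r j \<cdot> h)\<^sup>\<star> \<cdot> (r j \<cdot> h)) F"
  proof (rule YY.finsum_cong')
    show "(\<lambda>j. (r j \<cdot> h)\<^sup>\<star> \<cdot> (r j \<cdot> h)) \<in> F \<rightarrow> carrier (hom_group Y Y)"
      using Comp_in_Hom[OF rhh Star_in_Hom[OF rhh]] by (simp add: hom_group_def Pi_iff)
    show "h\<^sup>\<star> \<cdot> ((r j)\<^sup>\<star> \<cdot> (r j \<cdot> h)) = (r j \<cdot> h)\<^sup>\<star> \<cdot> (r j \<cdot> h)" if "j \<in> F" for j
      using rh[OF that] h by (simp add: Hom_def)
  qed simp
  finally show ?thesis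
    using orthonormal_product_expansion[OF r h] by (simp add: End_eq_hom_group)
qed

end


section \<open>Finite sums of a family\<close>

text \<open>A family of objects with chosen orthonormal products \<open>(p F j : Q F \<rightarrow> X j)\<close>, \<open>j \<in> F\<close>, of its finite
  subfamilies.\<close>

locale chosen_finite_sums = pre_hilbert_category +
  fixes J :: "'j set" and X Q p
  assumes family_obj: "\<forall>j \<in> J. X j \<in> Obj C"
    and chosen: "chosen_sums C J X Q p"
begin

lemma chosen_product: "F \<in> Fpow J \<Longrightarrow> orthonormal_product C F X (Q F) (p F)"
  using chosen unfolding chosen_sums_def by (elim conjE) (erule (1) bspec)

lemma singleton_sum: "j \<in> J \<Longrightarrow> Q {j} = X j" "j \<in> J \<Longrightarrow> p {j} j = Id C (X j)"
  using chosen unfolding chosen_sums_def by simp_all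

lemma singleton_in_Fpow: "j \<in> J \<Longrightarrow> {j} \<in> Fpow J"
  by (simp add: Fpow_def)

lemma in_Fpow_subset: "F \<in> Fpow J \<Longrightarrow> j \<in> F \<Longrightarrow> j \<in> J"
  by (auto simp: Fpow_def)

lemma sum_obj: "F \<in> Fpow J \<Longrightarrow> Q F \<in> Obj C"
  by (rule orthonormal_product_obj[OF chosen_product])

text \<open>The morphism into the chosen product over \<open>F\<close> with components \<open>g j\<close>, \<open>j \<in> F\<close>. Values of \<open>g\<close> outside
  \<open>F\<close> are ignored, so that one family serves for all \<open>F\<close>; \<open>Y\<close> is explicit because for \<open>F = {}\<close> the
  components do not determine the domain.\<close>

definition tuple :: "'j set \<Rightarrow> 'a \<Rightarrow> ('j \<Rightarrow> 'b) \<Rightarrow> 'b" where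
  "tuple F Y g = (THE h. h \<in> Hom C Y (Q F) \<and> (\<forall>j \<in> F. p F j \<cdot> h = g j))"

lemma sum_proj_eq_tuple: "sum_proj C Q p F G = tuple F (Q G) (p G)"
  by (simp add: sum_proj_def tuple_def)

lemma cone_of_span_eq:
  "cone_of_span C J Q p S = (fst S, \<lambda>F \<in> Fpow J. tuple F (fst S) (snd S))"
  by (simp add: cone_of_span_def tuple_def)

lemma
  assumes F: "F \<in> Fpow J" and Y: "Y \<in> Obj C" and g: "\<And>j. j \<in> F \<Longrightarrow> g j \<in> Hom C Y (X j)"
  shows tuple_in_Hom: "tuple F Y g \<in> Hom C Y (Q F)"
    and proj_tuple: "j \<in> F \<Longrightarrow> p F j \<cdot> tuple F Y g = g j"
  using theI'[OF orthonormal_product_ex1[OF chosen_product[OF F] Y g]] by (simp_all add: tuple_def)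

lemma tuple_eqI:
  assumes F: "F \<in> Fpow J" and h: "h \<in> Hom C Y (Q F)" and eq: "\<And>j. j \<in> F \<Longrightarrow> p F j \<cdot> h = g j"
  shows "tuple F Y g = h"
proof (rule orthonormal_product_eqI[OF chosen_product[OF F] _ h])
  have Y: "Y \<in> Obj C"
    using h hom_obj by blast
  have g: "g j \<in> Hom C Y (X j)" if "j \<in> F" for j
    using Comp_in_Hom[OF h orthonormal_product_hom[OF chosen_product[OF F] that]] eq[OF that] by simp
  show "tuple F Y g \<in> Hom C Y (Q F)"
    by (rule tuple_in_Hom[OF F Y g])
  show "p F j \<cdot> tuple F Y g = p F j \<cdot> h" if "j \<in> F" for j
    using proj_tuple[OF F Y g that] eq[OF that] by simp
qed

lemma tuple_norm:
  assumes F: "F \<in> Fpow J" and Y: "Y \<in> Obj C" and g: "\<And>j. j \<in> F \<Longrightarrow> g j \<in> Hom C Y (X j)"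
  shows "(tuple F Y g)\<^sup>\<star> \<cdot> tuple F Y g = finsum (End C Y) (\<lambda>j. (g j)\<^sup>\<star> \<cdot> g j) F"
proof -
  interpret YY: abelian_group "End C Y"
    unfolding End_eq_hom_group by (rule hom_group_abelian[OF Y Y])
  have "(tuple F Y g)\<^sup>\<star> \<cdot> tuple F Y g
      = finsum (End C Y) (\<lambda>j. (p F j \<cdot> tuple F Y g)\<^sup>\<star> \<cdot> (p F j \<cdot> tuple F Y g)) F"
    by (rule star_comp_eq_finsum[OF chosen_product[OF F] tuple_in_Hom[OF F Y g]])
  also have "\<dots> = finsum (End C Y) (\<lambda>j. (g j)\<^sup>\<star> \<cdot> g j) F"
  proof (rule YY.finsum_cong')
    show "(\<lambda>j. (g j)\<^sup>\<star> \<cdot> g j) \<in> F \<rightarrow> carrier (End C Y)"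
      using Comp_in_Hom[OF g Star_in_Hom[OF g]] by (simp add: End_def Pi_iff)
  qed (simp_all add: proj_tuple[OF F Y g])
  finally show ?thesis .
qed

lemma proj_in_Hom:
  assumes "F \<subseteq> G" "G \<in> Fpow J" "j \<in> F"
  shows "p G j \<in> Hom C (Q G) (X j)"
  using orthonormal_product_hom[OF chosen_product[OF assms(2)]] assms(1,3) by blast

lemma
  assumes F: "F \<in> Fpow J" and G: "G \<in> Fpow J" and sub: "F \<subseteq> G"
  shows sum_proj_in_Hom: "sum_proj C Q p F G \<in> Hom C (Q G) (Q F)"
    and proj_sum_proj: "j \<in> F \<Longrightarrow> p F j \<cdot> sum_proj C Q p F G = p G j"
proof -
  note typing = F sum_obj[OF G] proj_in_Hom[OF sub G]
  show "sum_proj C Q p F G \<in> Hom C (Q G) (Q F)"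
    unfolding sum_proj_eq_tuple by (rule tuple_in_Hom[OF typing])
  show "p F j \<cdot> sum_proj C Q p F G = p G j" if "j \<in> F"
    unfolding sum_proj_eq_tuple by (rule proj_tuple[OF typing that])
qed

lemma sum_proj_comp_tuple:
  assumes F: "F \<in> Fpow J" and G: "G \<in> Fpow J" and sub: "F \<subseteq> G"
    and Y: "Y \<in> Obj C" and g: "\<And>j. j \<in> G \<Longrightarrow> g j \<in> Hom C Y (X j)"
  shows "sum_proj C Q p F G \<cdot> tuple G Y g = tuple F Y g"
proof (rule tuple_eqI[OF F, symmetric])
  note t = tuple_in_Hom[OF G Y g] and s = sum_proj_in_Hom[OF F G sub]
  show "sum_proj C Q p F G \<cdot> tuple G Y g \<in> Hom C Y (Q F)"
    by (rule Comp_in_Hom[OF t s])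
  fix j
  assume j: "j \<in> F"
  have "p F j \<cdot> (sum_proj C Q p F G \<cdot> tuple G Y g) = (p F j \<cdot> sum_proj C Q p F G) \<cdot> tuple G Y g"
    by (rule Comp_assoc[OF t s orthonormal_product_hom[OF chosen_product[OF F] j], symmetric])
  then show "p F j \<cdot> (sum_proj C Q p F G \<cdot> tuple G Y g) = g j"
    using proj_sum_proj[OF F G sub j] proj_tuple[OF G Y g] j sub by auto
qed

lemma codirected_diagram_sums: "codirected_diagram C (Fpow J) (\<subseteq>) Q (sum_proj C Q p)"
  unfolding codirected_diagram_def
proof (intro conjI ballI impI)
  show "directed_set (Fpow J) (\<subseteq>)"
    unfolding directed_set_def
  proof (intro conjI ballI)
    show "Fpow J \<noteq> {}"
      by (auto simp: Fpow_def)
    show "\<exists>H \<in> Fpow J. F \<subseteq> H \<and> G \<subseteq> H" if "F \<in> Fpow J" "G \<in> Fpow J" for F G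
      using that by (intro bexI[of _ "F \<union> G"]) (auto simp: Fpow_def)
  qed auto
next
  fix F
  assume F: "F \<in> Fpow J"
  show "Q F \<in> Obj C"
    by (rule sum_obj[OF F])
  show "sum_proj C Q p F F = Id C (Q F)"
    unfolding sum_proj_eq_tuple
    by (rule tuple_eqI[OF F Id_in_Hom[OF sum_obj[OF F]]])
      (rule Comp_Id[OF orthonormal_product_hom[OF chosen_product[OF F]]])
next
  fix F G
  assume "F \<in> Fpow J" "G \<in> Fpow J" "F \<subseteq> G"
  then show "sum_proj C Q p F G \<in> Hom C (Q G) (Q F)"
    by (rule sum_proj_in_Hom)
next
  fix F G H
  assume F: "F \<in> Fpow J" and G: "G \<in> Fpow J" and H: "H \<in> Fpow J" and sub: "F \<subseteq> G \<and> G \<subseteq> H"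
  show "sum_proj C Q p F G \<cdot> sum_proj C Q p G H = sum_proj C Q p F H"
    unfolding sum_proj_eq_tuple[of G H] sum_proj_eq_tuple[of F H]
    by (rule sum_proj_comp_tuple[OF F G conjunct1[OF sub] sum_obj[OF H]
          proj_in_Hom[OF conjunct2[OF sub] H]])
qed

lemma coisometry_sum_proj:
  assumes F: "F \<in> Fpow J" and G: "G \<in> Fpow J" and sub: "F \<subseteq> G"
  shows "coisometry C (sum_proj C Q p F G)"
proof -
  let ?s = "sum_proj C Q p F G"
  note s = sum_proj_in_Hom[OF F G sub]
  note pF = orthonormal_product_hom[OF chosen_product[OF F]]
  have proj_adjoint: "?s \<cdot> (p G j)\<^sup>\<star> = (p F j)\<^sup>\<star>" if j: "j \<in> F" for j
  proof (rule orthonormal_product_eqI[OF chosen_product[OF F]])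
    note pG = proj_in_Hom[OF sub G]
    show "?s \<cdot> (p G j)\<^sup>\<star> \<in> Hom C (X j) (Q F)" "(p F j)\<^sup>\<star> \<in> Hom C (X j) (Q F)"
      by (rule Comp_in_Hom[OF Star_in_Hom[OF pG[OF j]] s], rule Star_in_Hom[OF pF[OF j]])
    fix k
    assume k: "k \<in> F"
    have jk: "j \<in> G" "k \<in> G"
      using j k sub by auto
    have "p F k \<cdot> (?s \<cdot> (p G j)\<^sup>\<star>) = (p F k \<cdot> ?s) \<cdot> (p G j)\<^sup>\<star>"
      by (rule Comp_assoc[OF Star_in_Hom[OF pG[OF j]] s pF[OF k], symmetric])
    also have "\<dots> = p G k \<cdot> (p G j)\<^sup>\<star>"
      by (simp only: proj_sum_proj[OF F G sub k])
    also have "\<dots> = p F k \<cdot> (p F j)\<^sup>\<star>"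
    proof (cases "k = j")
      case True
      then show ?thesis
        using orthonormal_product_same[OF chosen_product[OF F] j]
          orthonormal_product_same[OF chosen_product[OF G] jk(1)] by simp
    next
      case False
      then show ?thesis
        using orthonormal_product_diff[OF chosen_product[OF F] k j]
          orthonormal_product_diff[OF chosen_product[OF G] jk(2,1)] by simp
    qed
    finally show "p F k \<cdot> (?s \<cdot> (p G j)\<^sup>\<star>) = p F k \<cdot> (p F j)\<^sup>\<star>" .
  qed
  have "?s \<cdot> ?s\<^sup>\<star> = Id C (Q F)"
  proof (rule orthonormal_product_dual_eqI[OF chosen_product[OF F]])
    show "?s \<cdot> ?s\<^sup>\<star> \<in> Hom C (Q F) (Q F)" "Id C (Q F) \<in> Hom C (Q F) (Q F)"
      by (rule Comp_in_Hom[OF Star_in_Hom[OF s] s], rule Id_in_Hom[OF sum_obj[OF F]])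
    fix j
    assume j: "j \<in> F"
    have "(?s \<cdot> ?s\<^sup>\<star>) \<cdot> (p F j)\<^sup>\<star> = ?s \<cdot> (p F j \<cdot> ?s)\<^sup>\<star>"
      using s pF[OF j] by (simp add: Hom_def)
    also have "\<dots> = (p F j)\<^sup>\<star>"
      by (simp only: proj_sum_proj[OF F G sub j] proj_adjoint[OF j])
    finally show "(?s \<cdot> ?s\<^sup>\<star>) \<cdot> (p F j)\<^sup>\<star> = Id C (Q F) \<cdot> (p F j)\<^sup>\<star>"
      using Id_Comp[OF Star_in_Hom[OF pF[OF j]]] by simp
  qed
  then show ?thesis
    using s by (simp add: coisometry_def Hom_def)
qed

lemma contraction_sum_proj:
  assumes F: "F \<in> Fpow J" and G: "G \<in> Fpow J" and sub: "F \<subseteq> G"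
  shows "contraction C (sum_proj C Q p F G)"
proof -
  \<comment> \<open>\<open>?t\<close> is the projection onto the complementary summand, and \<open>1 = ?s\<^sup>\<star> \<cdot> ?s + ?t\<^sup>\<star> \<cdot> ?t\<close>\<close>
  let ?s = "sum_proj C Q p F G" and ?t = "sum_proj C Q p (G - F) G"
  let ?sq = "\<lambda>j. (p G j)\<^sup>\<star> \<cdot> p G j"
  have GF: "G - F \<in> Fpow J" "G - F \<subseteq> G"
    using G by (auto simp: Fpow_def)
  note s = sum_proj_in_Hom[OF F G sub] and t = sum_proj_in_Hom[OF GF(1) G GF(2)]
  note pG = orthonormal_product_hom[OF chosen_product[OF G]]
  have QG: "Q G \<in> Obj C"
    by (rule sum_obj[OF G])
  interpret E: abelian_group "End C (Q G)"
    unfolding End_eq_hom_group by (rule hom_group_abelian[OF QG QG])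
  have carrier: "carrier (End C (Q G)) = Hom C (Q G) (Q G)"
    by (simp add: End_def)
  have norm: "(sum_proj C Q p H G)\<^sup>\<star> \<cdot> sum_proj C Q p H G = finsum (End C (Q G)) ?sq H"
    if "H \<in> Fpow J" "H \<subseteq> G" for H
    unfolding sum_proj_eq_tuple by (rule tuple_norm[OF that(1) QG proj_in_Hom[OF that(2) G]])
  have fin: "finite F" "finite (G - F)"
    using F G by (auto simp: Fpow_def)
  have sq: "?sq j \<in> Hom C (Q G) (Q G)" if "j \<in> G" for j
    by (rule Comp_in_Hom[OF pG[OF that] Star_in_Hom[OF pG[OF that]]])
  have "Id C (Q G) = (sum_proj C Q p G G)\<^sup>\<star> \<cdot> sum_proj C Q p G G"
    using codirected_diagram_sums G QG by (simp add: codirected_diagram_def)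
  also have "\<dots> = finsum (End C (Q G)) ?sq (F \<union> (G - F))"
    using norm[OF G subset_refl] sub by (simp add: Un_absorb1)
  also have "\<dots> = finsum (End C (Q G)) ?sq F \<oplus>\<^bsub>End C (Q G)\<^esub> finsum (End C (Q G)) ?sq (G - F)"
    by (rule E.finsum_Un_disjoint[OF fin]) (use sq sub in \<open>auto simp: carrier\<close>)
  also have "\<dots> = ?s\<^sup>\<star> \<cdot> ?s \<oplus>\<^bsub>End C (Q G)\<^esub> ?t\<^sup>\<star> \<cdot> ?t"
    using norm[OF F sub] norm[OF GF] by simp
  finally have Id_eq: "Id C (Q G) = ?s\<^sup>\<star> \<cdot> ?s \<oplus>\<^bsub>End C (Q G)\<^esub> ?t\<^sup>\<star> \<cdot> ?t" .
  have sq_carrier: "?s\<^sup>\<star> \<cdot> ?s \<in> carrier (End C (Q G))" "?t\<^sup>\<star> \<cdot> ?t \<in> carrier (End C (Q G))"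
    unfolding carrier
    by (rule Comp_in_Hom[OF s Star_in_Hom[OF s]], rule Comp_in_Hom[OF t Star_in_Hom[OF t]])
  have "Id C (Q G) \<ominus>\<^bsub>End C (Q G)\<^esub> ?s\<^sup>\<star> \<cdot> ?s = ?t\<^sup>\<star> \<cdot> ?t"
    unfolding Id_eq E.a_comm[OF sq_carrier]
    using sq_carrier by (simp add: E.minus_eq E.a_assoc E.r_neg)
  moreover have "?s \<in> Arr C" "Dom C ?s = Q G" "?t \<in> Arr C" "Dom C ?t = Q G"
    using s t by (simp_all add: Hom_def)
  ultimately show ?thesis
    unfolding contraction_def Herm_def by auto
qed


section \<open>Spans and cones\<close>

lemma span_component: "S \<in> spans C J X \<Longrightarrow> j \<in> J \<Longrightarrow> snd S j \<in> Hom C (fst S) (X j)"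
  by (cases S) (auto simp: spans_def dest: PiE_mem)

lemma span_obj: "S \<in> spans C J X \<Longrightarrow> fst S \<in> Obj C"
  by (cases S) (simp add: spans_def)

lemma span_component_in_Fpow:
  "S \<in> spans C J X \<Longrightarrow> F \<in> Fpow J \<Longrightarrow> j \<in> F \<Longrightarrow> snd S j \<in> Hom C (fst S) (X j)"
  using span_component in_Fpow_subset by blast

lemma fst_cone_of_span [simp]: "fst (cone_of_span C J Q p S) = fst S"
  by (simp add: cone_of_span_def)

lemma snd_cone_of_span:
  "F \<in> Fpow J \<Longrightarrow> snd (cone_of_span C J Q p S) F = tuple F (fst S) (snd S)"
  by (simp add: cone_of_span_eq)

lemma cone_of_span_in_cones:
  assumes S: "S \<in> spans C J X"
  shows "cone_of_span C J Q p S \<in> cones C (Fpow J) (\<subseteq>) Q (sum_proj C Q p)"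
proof -
  have "cone_of_span C J Q p S \<in> spans C (Fpow J) Q"
    using span_obj[OF S] tuple_in_Hom[OF _ span_obj[OF S] span_component_in_Fpow[OF S]]
    by (simp add: cone_of_span_eq spans_def)
  moreover have "sum_proj C Q p F G \<cdot> snd (cone_of_span C J Q p S) G
      = snd (cone_of_span C J Q p S) F" if "F \<in> Fpow J" "G \<in> Fpow J" "F \<subseteq> G" for F G
    using sum_proj_comp_tuple[OF that span_obj[OF S] span_component_in_Fpow[OF S that(2)]] that
    by (simp add: snd_cone_of_span)
  ultimately show ?thesis
    by (simp add: cones_def)
qed

lemma cone_component:
  "T \<in> cones C (Fpow J) (\<subseteq>) Q (sum_proj C Q p) \<Longrightarrow> F \<in> Fpow J
    \<Longrightarrow> snd T F \<in> Hom C (fst T) (Q F)"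
  by (cases T) (auto simp: cones_def spans_def dest: PiE_mem)

lemma span_of_cone_in_spans:
  assumes T: "T \<in> cones C (Fpow J) (\<subseteq>) Q (sum_proj C Q p)"
  shows "span_of_cone J T \<in> spans C J X"
proof -
  have "fst T \<in> Obj C"
    using T by (cases T) (simp add: cones_def spans_def)
  moreover have "snd T {j} \<in> Hom C (fst T) (X j)" if "j \<in> J" for j
    using cone_component[OF T singleton_in_Fpow[OF that]] singleton_sum(1)[OF that] by simp
  ultimately show ?thesis
    by (simp add: span_of_cone_def spans_def)
qed

lemma span_of_cone_of_span:
  assumes S: "S \<in> spans C J X"
  shows "span_of_cone J (cone_of_span C J Q p S) = S"
proof -
  have "tuple {j} (fst S) (snd S) = snd S j" if j: "j \<in> J" for j
  proof (rule tuple_eqI[OF singleton_in_Fpow[OF j]])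
    show "snd S j \<in> Hom C (fst S) (Q {j})"
      using span_component[OF S j] singleton_sum(1)[OF j] by simp
    show "p {j} k \<cdot> snd S j = snd S k" if "k \<in> {j}" for k
      using that singleton_sum(2)[OF j] Id_Comp[OF span_component[OF S j]] by simp
  qed
  moreover have "snd S \<in> extensional J"
    using S by (cases S) (simp add: spans_def PiE_def)
  ultimately have "(\<lambda>j \<in> J. snd (cone_of_span C J Q p S) {j}) = snd S"
    by (intro extensionalityI[of _ J]) (simp_all add: snd_cone_of_span singleton_in_Fpow)
  then show ?thesis
    by (simp add: span_of_cone_def prod_eq_iff)
qed

lemma cone_of_span_of_cone:
  assumes T: "T \<in> cones C (Fpow J) (\<subseteq>) Q (sum_proj C Q p)"
  shows "cone_of_span C J Q p (span_of_cone J T) = T"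
proof -
  have "tuple F (fst T) (\<lambda>j \<in> J. snd T {j}) = snd T F" if F: "F \<in> Fpow J" for F
  proof (rule tuple_eqI[OF F cone_component[OF T F]])
    fix j
    assume j: "j \<in> F"
    then have J: "j \<in> J" and sub: "{j} \<subseteq> F"
      using in_Fpow_subset[OF F] by auto
    have proj: "sum_proj C Q p {j} F \<in> Hom C (Q F) (X j)"
      using sum_proj_in_Hom[OF singleton_in_Fpow[OF J] F sub] singleton_sum(1)[OF J] by simp
    \<comment> \<open>the projection onto a one-object summand is the product projection\<close>
    have "sum_proj C Q p {j} F = p F j"
      using proj_sum_proj[OF singleton_in_Fpow[OF J] F sub, of j] singleton_sum(2)[OF J]
        Id_Comp[OF proj] by simp
    moreover have "sum_proj C Q p {j} F \<cdot> snd T F = snd T {j}"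
      using T F singleton_in_Fpow[OF J] sub unfolding cones_def by blast
    ultimately show "p F j \<cdot> snd T F = (\<lambda>j \<in> J. snd T {j}) j"
      using J by simp
  qed
  moreover have "snd T \<in> extensional (Fpow J)"
    using T by (cases T) (simp add: cones_def spans_def PiE_def)
  ultimately have "snd (cone_of_span C J Q p (span_of_cone J T)) = snd T"
    by (intro extensionalityI[of _ "Fpow J"]) (simp_all add: cone_of_span_eq span_of_cone_def)
  then show ?thesis
    by (simp add: prod_eq_iff) (simp add: span_of_cone_def)
qed

lemma bij_betw_cone_of_span:
  "bij_betw (cone_of_span C J Q p) (spans C J X) (cones C (Fpow J) (\<subseteq>) Q (sum_proj C Q p))"
  by (rule bij_betw_byWitness[of _ "span_of_cone J"])
    (auto simp: span_of_cone_of_span cone_of_span_of_cone cone_of_span_in_cones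
      span_of_cone_in_spans)

lemma inv_cone_of_span:
  assumes T: "T \<in> cones C (Fpow J) (\<subseteq>) Q (sum_proj C Q p)"
  shows "inv_into (spans C J X) (cone_of_span C J Q p) T = span_of_cone J T"
  by (rule inv_into_f_eq[OF bij_betw_imp_inj_on[OF bij_betw_cone_of_span]
        span_of_cone_in_spans[OF T] cone_of_span_of_cone[OF T]])

lemma span_hom_cone_of_span:
  assumes S: "S \<in> spans C J X" and S': "S' \<in> spans C J X"
  shows "span_hom C J S S'
    = span_hom C (Fpow J) (cone_of_span C J Q p S) (cone_of_span C J Q p S')"
proof -
  have "(\<forall>j \<in> J. snd S' j \<cdot> h = snd S j)
      \<longleftrightarrow> (\<forall>F \<in> Fpow J. tuple F (fst S') (snd S') \<cdot> h = tuple F (fst S) (snd S))"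
    if h: "h \<in> Hom C (fst S) (fst S')" for h
  proof -
    have t: "tuple F (fst S') (snd S') \<in> Hom C (fst S') (Q F)" if "F \<in> Fpow J" for F
      by (rule tuple_in_Hom[OF that span_obj[OF S'] span_component_in_Fpow[OF S' that]])
    have proj: "p F j \<cdot> (tuple F (fst S') (snd S') \<cdot> h) = snd S' j \<cdot> h"
      if F: "F \<in> Fpow J" and j: "j \<in> F" for F j
    proof -
      have "p F j \<cdot> (tuple F (fst S') (snd S') \<cdot> h) = (p F j \<cdot> tuple F (fst S') (snd S')) \<cdot> h"
        by (rule Comp_assoc[OF h t[OF F] orthonormal_product_hom[OF chosen_product[OF F] j],
              symmetric])
      then show ?thesis
        using proj_tuple[OF F span_obj[OF S'] span_component_in_Fpow[OF S' F] j] by simp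
    qed
    show ?thesis
    proof (intro iffI ballI)
      fix F
      assume eq: "\<forall>j \<in> J. snd S' j \<cdot> h = snd S j" and F: "F \<in> Fpow J"
      show "tuple F (fst S') (snd S') \<cdot> h = tuple F (fst S) (snd S)"
      proof (rule tuple_eqI[OF F Comp_in_Hom[OF h t[OF F]], symmetric])
        show "p F j \<cdot> (tuple F (fst S') (snd S') \<cdot> h) = snd S j" if "j \<in> F" for j
          using proj[OF F that] eq in_Fpow_subset[OF F that] by simp
      qed
    next
      fix j
      assume eq: "\<forall>F \<in> Fpow J. tuple F (fst S') (snd S') \<cdot> h = tuple F (fst S) (snd S)"
        and j: "j \<in> J"
      note F = singleton_in_Fpow[OF j]
      have "tuple {j} (fst S') (snd S') \<cdot> h = tuple {j} (fst S) (snd S)"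
        using eq F by blast
      then show "snd S' j \<cdot> h = snd S j"
        using proj[OF F, of j] proj_tuple[OF F span_obj[OF S] span_component_in_Fpow[OF S F], of j]
        by simp
    qed
  qed
  then show ?thesis
    unfolding span_hom_def by (auto simp: snd_cone_of_span)
qed


section \<open>Square-summable spans and cones\<close>

lemma cone_net_cone_of_span:
  assumes S: "S \<in> spans C J X" and F: "F \<in> Fpow J"
  shows "cone_net C (cone_of_span C J Q p S) F = l2_net C S F"
  using tuple_norm[OF F span_obj[OF S] span_component_in_Fpow[OF S F]]
  by (simp add: cone_net_def l2_net_def snd_cone_of_span[OF F])

lemma cone_net_image:
  "S \<in> spans C J X
    \<Longrightarrow> cone_net C (cone_of_span C J Q p S) ` Fpow J = l2_net C S ` Fpow J"
  by (rule image_cong[OF refl cone_net_cone_of_span])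

lemma l2_spans_iff_l2_cones:
  assumes S: "S \<in> spans C J X"
  shows "S \<in> l2_spans C J X
    \<longleftrightarrow> cone_of_span C J Q p S \<in> l2_cones C (Fpow J) (\<subseteq>) Q (sum_proj C Q p)"
  using S cone_of_span_in_cones[OF S] by (simp add: l2_spans_def l2_cones_def cone_net_image)

lemma l2_cones_eq_image:
  "l2_cones C (Fpow J) (\<subseteq>) Q (sum_proj C Q p) = cone_of_span C J Q p ` l2_spans C J X"
proof (intro equalityI subsetI)
  fix T
  assume T: "T \<in> l2_cones C (Fpow J) (\<subseteq>) Q (sum_proj C Q p)"
  then have T': "T \<in> cones C (Fpow J) (\<subseteq>) Q (sum_proj C Q p)"
    by (simp add: l2_cones_def)
  then have "span_of_cone J T \<in> l2_spans C J X"
    using T l2_spans_iff_l2_cones[OF span_of_cone_in_spans] cone_of_span_of_cone by simp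
  then show "T \<in> cone_of_span C J Q p ` l2_spans C J X"
    using cone_of_span_of_cone[OF T'] by (intro image_eqI) simp_all
next
  fix T
  assume "T \<in> cone_of_span C J Q p ` l2_spans C J X"
  then obtain S where S: "S \<in> l2_spans C J X" "T = cone_of_span C J Q p S"
    by blast
  then have "S \<in> spans C J X"
    by (simp add: l2_spans_def)
  then show "T \<in> l2_cones C (Fpow J) (\<subseteq>) Q (sum_proj C Q p)"
    using S l2_spans_iff_l2_cones by simp
qed

lemma l2_products_iff_l2_limits:
  assumes R: "R \<in> spans C J X"
  shows "R \<in> l2_products C J X
    \<longleftrightarrow> cone_of_span C J Q p R \<in> l2_limits C (Fpow J) (\<subseteq>) Q (sum_proj C Q p)"
proof -
  have "span_hom C (Fpow J) (cone_of_span C J Q p S) (cone_of_span C J Q p R) = span_hom C J S R"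
    and "cone_net C (cone_of_span C J Q p S) ` Fpow J = l2_net C S ` Fpow J"
    if "S \<in> l2_spans C J X" for S
    using that span_hom_cone_of_span[OF _ R, of S] cone_net_image[of S]
    by (simp_all add: l2_spans_def)
  then show ?thesis
    unfolding l2_products_def l2_limits_def mem_Collect_eq l2_spans_iff_l2_cones[OF R, symmetric]
    unfolding l2_cones_eq_image by simp
qed

end


theorem proposition4p14:
  fixes C :: "('o, 'a) star_cat"
    and J :: "'j set" and X :: "'j \<Rightarrow> 'o"
    and Q :: "'j set \<Rightarrow> 'o" and p :: "'j set \<Rightarrow> 'j \<Rightarrow> 'a"
  assumes "pre_hilbert_category C"
    and "\<forall>j \<in> J. X j \<in> Obj C"
    and "chosen_sums C J X Q p"
  defines "Spans \<equiv> spans C J X"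
    and "Cones \<equiv> cones C (Fpow J) (\<subseteq>) Q (sum_proj C Q p)"
    and "\<Phi> \<equiv> cone_of_span C J Q p"
  shows
    \<comment> \<open>the diagram is a codirected diagram of coisometries, hence of contractions\<close>
    "codirected_diagram C (Fpow J) (\<subseteq>) Q (sum_proj C Q p)
     \<and> (\<forall>F \<in> Fpow J. \<forall>G \<in> Fpow J. F \<subseteq> G \<longrightarrow>
          coisometry C (sum_proj C Q p F G) \<and> contraction C (sum_proj C Q p F G))
     \<comment> \<open>the canonical isomorphism of categories, the identity on underlying morphisms\<close>
     \<and> bij_betw \<Phi> Spans Cones
     \<and> (\<forall>T \<in> Cones. inv_into Spans \<Phi> T = span_of_cone J T)
     \<and> (\<forall>S \<in> Spans. \<forall>S' \<in> Spans. span_hom C J S S' = span_hom C (Fpow J) (\<Phi> S) (\<Phi> S'))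
     \<comment> \<open>the correspondences\<close>
     \<and> (\<forall>S \<in> Spans. S \<in> l2_spans C J X
          \<longleftrightarrow> \<Phi> S \<in> l2_cones C (Fpow J) (\<subseteq>) Q (sum_proj C Q p))
     \<and> (\<forall>S \<in> Spans. S \<in> l2_products C J X
          \<longleftrightarrow> \<Phi> S \<in> l2_limits C (Fpow J) (\<subseteq>) Q (sum_proj C Q p))"
proof -
  interpret chosen_finite_sums C J X Q p
    using assms(1-3) by (simp add: chosen_finite_sums_def chosen_finite_sums_axioms_def)
  show ?thesis
    unfolding Spans_def Cones_def \<Phi>_def
    by (intro conjI ballI impI codirected_diagram_sums coisometry_sum_proj contraction_sum_proj
        bij_betw_cone_of_span inv_cone_of_span span_hom_cone_of_span
        l2_spans_iff_l2_cones l2_products_iff_l2_limits)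
qed

end
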